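(* Fix $\hat r>0$ and let $\mathbb{G}$ be the set of all $\gamma$ such that $\gamma$ is a $C^2$ simple closed curve in $\mathbb{R}^2$ which is tangentially graph-like (TGL) for the radius $r=\hat r$. Suppose that, for $r=\hat r$, for all $s\in[0,L]$ (with $L$ the length of $\gamma$), and for each $\gamma\in\mathbb{G}$, we know the first-, second-, and third-order partial derivatives of $g_\gamma(s,r)$. Then the set of reconstructible $\gamma\in\mathbb{G}$ is $C^1$ dense in $\mathbb{G}$, where reconstructibility is modulo reparametrization, translation, and rotation.
   Context: For a simple closed curve $\gamma$ of length $L$, bounding a compact region $\Omega\subset\mathbb{R}^2$, $\gamma:[0,L]\to\partial\Omega$ also denotes an arclength parameterization traversing $\partial\Omega$ counterclockwise (interior on the left), $\gamma(0)=\gamma(L)$, injective on $[0,L)$. $D(p,r)$ is the closed disk of radius $r$ centered at $p$. The integral area invariant of $\gamma$ is $g_\gamma(s,r)=\mathrm{Area}(\Omega\cap D(\gamma(s),r))$. TGL: a continuously differentiable $\partial\Omega$ is tangentially graph-like at $p\in\partial\Omega$ with radius $r$ if there is a Cartesian coordinate system with origin $p$ in which $\partial\Omega\cap D(p,r)$ is the graph of a function $f$ with $f(0)=0$ and $f'(0)=0$ (oriented so that $(0,\epsilon)\in\Omega$ for small $\epsilon>0$). It is TGL for radius $r$ if this holds at every $p\in\partial\Omega$. A curve $\gamma\in\mathbb{G}$ is reconstructible (modulo reparametrization, translation and rotation) if it is determined, up to these operations, by the data consisting of the partial derivatives of orders one, two and three (those that exist) of $g_\gamma$ with respect to $s$ and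 $r$, evaluated at $(s,\hat r)$ for all $s\in[0,L]$; i.e. any curve in $\mathbb{G}$ with the same data is the image of $\gamma$ under a composition of a translation and a rotation, up to reparametrization. $C^1$ dense means that every $\gamma\in\mathbb{G}$ can be approximated arbitrarily well, in the $C^1$ sense (position and tangent direction, after suitable parametrization on a common domain), by reconstructible curves in $\mathbb{G}$. *)

theory Defs
  imports "HOL-Analysis.Analysis"
begin

text \<open>
  The plane is the type \<^typ>\<open>complex\<close>. A closed curve of length \<open>L\<close> is a pair \<open>(L, \<gamma>)\<close>, where \<open>\<gamma>\<close> is
  the \<open>L\<close>-periodic extension to the real line of an arclength parametrization on \<open>[0, L]\<close>; in this
  way smoothness, tangents and derivatives in \<open>s\<close> also make sense at the base point.
\<close>

type_synonym closed_curve = "real \<times> (real \<Rightarrow> complex)"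

definition region :: "real \<Rightarrow> (real \<Rightarrow> complex) \<Rightarrow> complex set" where
  "region L \<gamma> = \<gamma> ` {0..L} \<union> inside (\<gamma> ` {0..L})"

text \<open>
  The last clause is the counterclockwise orientation: multiplication by \<^term>\<open>\<i>\<close> turns the tangent
  vector into the left normal, which has to point into the interior.
\<close>

definition C2_simple_closed_curve :: "real \<Rightarrow> (real \<Rightarrow> complex) \<Rightarrow> bool" where
  "C2_simple_closed_curve L \<gamma> \<longleftrightarrow>
     0 < L \<and> (\<forall>s. \<gamma> (s + L) = \<gamma> s) \<and> inj_on \<gamma> {0..<L} \<and>
     \<gamma> C1_differentiable_on UNIV \<and>
     (\<lambda>s. vector_derivative \<gamma> (at s)) C1_differentiable_on UNIV \<and>
     (\<forall>s. norm (vector_derivative \<gamma> (at s)) = 1) \<and>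
     (\<forall>s. \<forall>\<^sub>F \<epsilon> in at_right (0::real).
        \<gamma> s + of_real \<epsilon> * \<i> * vector_derivative \<gamma> (at s) \<in> inside (\<gamma> ` {0..L}))"

definition area_invariant :: "real \<Rightarrow> (real \<Rightarrow> complex) \<Rightarrow> real \<Rightarrow> real \<Rightarrow> real" where
  "area_invariant L \<gamma> s r = measure lebesgue (region L \<gamma> \<inter> cball (\<gamma> s) r)"

text \<open>
  The unit complex number \<open>u\<close> is the direction of the first axis of the Cartesian coordinate system,
  so the point with coordinates \<open>(x, y)\<close> is \<open>p + u * Complex x y\<close>. The set \<open>A\<close> is the domain of the
  function, which has to contain a neighbourhood of \<open>0\<close> for the condition \<open>f'(0) = 0\<close> to make sense.
\<close>

definition tangentially_graph_like_at :: "complex set \<Rightarrow> complex \<Rightarrow> real \<Rightarrow> bool" where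
  "tangentially_graph_like_at \<Omega> p r \<longleftrightarrow>
     (\<exists>u A f. norm u = 1 \<and> 0 \<in> interior A \<and>
        frontier \<Omega> \<inter> cball p r = (\<lambda>x. p + u * Complex x (f x)) ` A \<and>
        f 0 = 0 \<and> (f has_real_derivative 0) (at 0) \<and>
        (\<forall>\<^sub>F \<epsilon> in at_right 0. p + u * Complex 0 \<epsilon> \<in> \<Omega>))"

definition tangentially_graph_like :: "complex set \<Rightarrow> real \<Rightarrow> bool" where
  "tangentially_graph_like \<Omega> r \<longleftrightarrow> (\<forall>p\<in>frontier \<Omega>. tangentially_graph_like_at \<Omega> p r)"

definition TGL_curves :: "real \<Rightarrow> closed_curve set" where
  "TGL_curves r =
     {(L, \<gamma>). C2_simple_closed_curve L \<gamma> \<and> tangentially_graph_like (region L \<gamma>) r}"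

text \<open>
  \<open>has_partial w g s r v\<close>: the iterated partial derivative of \<open>g\<close> given by the word \<open>w\<close> (rightmost
  letter applied first) exists at \<open>(s, r)\<close> and equals \<open>v\<close>. The next lower derivative has to exist on
  a neighbourhood along the line in which it is differentiated; \<open>h\<close> is that lower derivative there.
\<close>

datatype direction = Dir_s | Dir_r

primrec has_partial ::
  "direction list \<Rightarrow> (real \<Rightarrow> real \<Rightarrow> real) \<Rightarrow> real \<Rightarrow> real \<Rightarrow> real \<Rightarrow> bool" where
  "has_partial [] g s r v \<longleftrightarrow> g s r = v"
| "has_partial (d # w) g s r v \<longleftrightarrow>
     (case d of
        Dir_s \<Rightarrow> \<exists>h. (\<forall>\<^sub>F x in nhds s. has_partial w g x r (h x)) \<and> (h has_real_derivative v) (at s)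
      | Dir_r \<Rightarrow> \<exists>h. (\<forall>\<^sub>F y in nhds r. has_partial w g s y (h y)) \<and> (h has_real_derivative v) (at r))"

text \<open>
  The data are partial functions of \<open>s \<in> [0, L]\<close>, so equality of data comprises equality of the
  lengths and of the sets of points where the respective derivative exists.
\<close>

fun same_data :: "real \<Rightarrow> closed_curve \<Rightarrow> closed_curve \<Rightarrow> bool" where
  "same_data r (L, \<gamma>) (M, \<eta>) \<longleftrightarrow>
     L = M \<and>
     (\<forall>w. length w \<in> {1..3} \<longrightarrow>
        (\<forall>s\<in>{0..L}. \<forall>v. has_partial w (area_invariant L \<gamma>) s r v \<longleftrightarrow>
                        has_partial w (area_invariant M \<eta>) s r v))"

text \<open>
  A reparametrization of closed curves is given by a lift \<open>\<phi>\<close> of an orientation preserving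
  homeomorphism between the circles of lengths \<open>M\<close> and \<open>L\<close>.
\<close>

fun equal_up_to_motion :: "closed_curve \<Rightarrow> closed_curve \<Rightarrow> bool" where
  "equal_up_to_motion (L, \<gamma>) (M, \<eta>) \<longleftrightarrow>
     (\<exists>a \<theta> \<phi>. continuous_on UNIV \<phi> \<and> strict_mono \<phi> \<and> (\<forall>s. \<phi> (s + M) = \<phi> s + L) \<and>
        (\<forall>s. \<eta> s = a + cis \<theta> * \<gamma> (\<phi> s)))"

definition reconstructible :: "real \<Rightarrow> closed_curve \<Rightarrow> bool" where
  "reconstructible r c \<longleftrightarrow>
     (\<forall>c'\<in>TGL_curves r. same_data r c c' \<longrightarrow> equal_up_to_motion c c')"

text \<open>
  Closeness of positions and unit tangents for the constant speed parametrizations on the common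
  domain \<open>[0, 1]\<close>.
\<close>

fun C1_close :: "real \<Rightarrow> closed_curve \<Rightarrow> closed_curve \<Rightarrow> bool" where
  "C1_close \<epsilon> (L, \<gamma>) (M, \<eta>) \<longleftrightarrow>
     (\<forall>t\<in>{0..1}. dist (\<gamma> (L * t)) (\<eta> (M * t)) < \<epsilon> \<and>
        dist (vector_derivative \<gamma> (at (L * t))) (vector_derivative \<eta> (at (M * t))) < \<epsilon>)"

definition C1_dense_in :: "closed_curve set \<Rightarrow> closed_curve set \<Rightarrow> bool" where
  "C1_dense_in D G \<longleftrightarrow> D \<subseteq> G \<and> (\<forall>c\<in>G. \<forall>\<epsilon>>0. \<exists>d\<in>D. C1_close \<epsilon> c d)"

end

theory Submission
  imports Defs
begin

text \<open>
  Every curve in \<open>\<bbbG>\<close> is reconstructible, so each curve approximates itself.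

  Let \<open>p\<close> be a point of the curve. By the graph property no other point \<open>q\<close> of the curve within
  distance \<open>r\<close> of \<open>p\<close> lies on the normal line at \<open>p\<close>. Read with \<open>p\<close> and \<open>q\<close> interchanged, this says
  that the curve is not tangent at \<open>q\<close> to the circle around \<open>p\<close> through \<open>q\<close>; in other words, along
  the curve the distance from \<open>p\<close> has no critical value in \<open>(0, r]\<close>, and by compactness none in
  \<open>(0, R)\<close> for some \<open>R > r\<close>. Therefore the curve leaves the disk of radius \<open>\<rho> < R\<close> around \<open>p\<close> exactly
  once and enters it exactly once, transversally, at points that depend differentiably on \<open>\<rho>\<close> and on
  the arclength \<open>s\<close> of \<open>p\<close>. In the frame given by the tangent and the inner normal at \<open>p\<close> the exit
  point has a polar angle \<open>\<alpha>\<close> and the entry point a polar angle \<open>\<pi> + \<beta>\<close>, where \<open>\<bar>\<alpha>\<bar>\<close> and \<open>\<bar>\<beta>\<bar>\<close> are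
  less than \<open>\<pi>/2\<close>. By the Jordan curve theorem the part of the circle of radius \<open>\<rho>\<close> in \<open>\<Omega>\<close> is the arc
  between these angles, whence
  \<open>g\<^sub>r = \<rho> (\<pi> + \<beta> - \<alpha>)\<close> (\<open>disk_area_deriv_radius\<close>). Integrating this from radius \<open>0\<close> gives an
  expression of \<open>g\<close> by the two angles and line integrals along the curve (\<open>disk_area_eq\<close>), which can
  be differentiated along the curve: \<open>g\<^sub>s = - \<rho> (sin \<alpha> + sin \<beta>)\<close> (\<open>disk_area_deriv_base\<close>).

  The angles move according to
  \<open>\<alpha>\<^sub>s = sin \<alpha> / \<rho> + cos \<alpha> \<cdot> \<alpha>\<^sub>r - \<kappa>\<close> and \<open>- \<beta>\<^sub>s = sin \<beta> / \<rho> + cos \<beta> \<cdot> \<beta>\<^sub>r + \<kappa>\<close>, with \<open>\<kappa>\<close> the curvature at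
  \<open>p\<close> (\<open>exit_angle_partials\<close>, \<open>entry_tilt_partials\<close>). The functions \<open>g\<^sub>r\<close> and \<open>g\<^sub>s\<close> of \<open>s\<close> determine
  \<open>\<alpha>\<close> and \<open>\<beta>\<close>, so also \<open>\<alpha>\<^sub>s\<close> and \<open>\<beta>\<^sub>s\<close>. The sum of the two equations then gives
  \<open>cos \<alpha> \<cdot> \<alpha>\<^sub>r + cos \<beta> \<cdot> \<beta>\<^sub>r\<close>, while \<open>g\<^sub>r\<^sub>r\<close> gives \<open>\<beta>\<^sub>r - \<alpha>\<^sub>r\<close>. Since both cosines are positive, these
  two numbers determine \<open>\<alpha>\<^sub>r\<close>, and the first equation determines \<open>\<kappa>\<close>. The curvature as a function
  of arclength determines the curve up to a motion.
\<close>

section \<open>Areas of annular sectors\<close>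

lemma continuous_on_vector_Re_Im: "continuous_on S (\<lambda>z. vector [Re z, Im z] :: real^2)"
proof -
  have "(\<lambda>z. vector [Re z, Im z] :: real^2) = (\<lambda>z. \<chi> i. if i = 1 then Re z else Im z)"
    by (auto simp: fun_eq_iff vec_eq_iff forall_2)
  moreover have "continuous_on S (\<lambda>z. if i = 1 then Re z else Im z)" for i :: 2
    by (cases "i = 1") (auto intro!: continuous_intros)
  ultimately show ?thesis
    by (simp only:) (rule continuous_on_vec_lambda)
qed

lemma lborel_complex_distr_real2:
  "(lborel :: (real^2) measure) = distr lborel borel (\<lambda>z::complex. vector [Re z, Im z])"
proof (rule lborel_eqI)
  let ?f = "\<lambda>z::complex. vector [Re z, Im z] :: real^2"
  have cont: "continuous_on UNIV ?f"
    by (rule continuous_on_vector_Re_Im)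
  then have meas: "?f \<in> borel_measurable borel"
    by (rule borel_measurable_continuous_onI)
  fix l u :: "real^2"
  assume "\<And>b. b \<in> Basis \<Longrightarrow> l \<bullet> b \<le> u \<bullet> b"
  then have le: "l $ i \<le> u $ i" for i
    by (metis axis_in_Basis_iff cart_eq_inner_axis Basis_real_def insertI1)
  have "emeasure (distr lborel borel ?f) (box l u) = emeasure lborel (?f -` box l u)"
    using meas by (simp add: emeasure_distr)
  also have "?f -` box l u = box (Complex (l$1) (l$2)) (Complex (u$1) (u$2))"
    by (auto simp: mem_box_cart forall_2 in_box_complex_iff)
  also have "emeasure lborel \<dots> = (\<Prod>b\<in>Basis. (Complex (u$1) (u$2) - Complex (l$1) (l$2)) \<bullet> b)"
    using le[of 1] le[of 2] by (intro emeasure_lborel_box) (auto simp: Basis_complex_def)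
  also have "\<dots> = (\<Prod>b\<in>Basis. (u - l) \<bullet> b)"
  proof -
    have "(\<Prod>b\<in>Basis. (u - l) \<bullet> b) = (\<Prod>i\<in>UNIV. (u - l) \<bullet> axis i 1)"
    proof -
      have B: "(Basis :: (real^2) set) = (\<lambda>i. axis i 1) ` UNIV"
        by (auto simp: Basis_vec_def)
      have "inj_on (\<lambda>i::2. axis i (1::real)) UNIV"
        by (auto simp: inj_on_def axis_eq_axis)
      then show ?thesis
        unfolding B by (subst prod.reindex) (auto simp: o_def)
    qed
    then show ?thesis
      by (simp add: UNIV_2 cart_eq_inner_axis[symmetric] Basis_complex_def inner_complex_def)
  qed
  finally show "emeasure (distr lborel borel ?f) (box l u) = (\<Prod>b\<in>Basis. (u - l) \<bullet> b)" .
qed simp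

text \<open>Transported from the invariance under orthogonal maps of Lebesgue measure on \<open>\<real>\<^sup>2\<close>.\<close>

lemma measure_rotation_complex:
  fixes S :: "complex set"
  assumes u: "norm u = 1" and S: "S \<in> sets borel" "bounded S"
  shows "measure lebesgue ((*) u ` S) = measure lebesgue S"
proof -
  let ?f = "\<lambda>z::complex. vector [Re z, Im z] :: real^2"
  let ?g = "\<lambda>v::real^2. Complex (v$1) (v$2)"
  have gf: "?g (?f z) = z" and fg: "?f (?g v) = v" for z v
    by (auto simp: vec_eq_iff forall_2)
  have contg: "continuous_on UNIV ?g"
    by (auto simp: Complex_eq intro!: continuous_intros)
  have contf: "continuous_on UNIV ?f"
    by (rule continuous_on_vector_Re_Im)
  then have meas: "?f \<in> borel_measurable borel"
    by (rule borel_measurable_continuous_onI)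
  have img: "?f ` A = ?g -` A" for A
    using gf fg by (auto simp: image_iff intro!: bexI[of _ "?g _"])
  have bor: "?f ` A \<in> sets borel" if "A \<in> sets borel" for A
  proof -
    have "?g \<in> borel_measurable borel"
      using contg by (rule borel_measurable_continuous_onI)
    from measurable_sets_borel[OF this that] show ?thesis
      unfolding img .
  qed
  have pres: "measure lebesgue (?f ` A) = measure lebesgue A" if A: "A \<in> sets borel" for A
  proof -
    have "emeasure lborel (?f ` A) = emeasure lborel (?f -` (?f ` A))"
      by (subst lborel_complex_distr_real2, subst emeasure_distr) (use meas bor[OF A] in auto)
    also have "?f -` (?f ` A) = A"
      by (metis (no_types, lifting) gf inj_onI inj_vimage_image_eq)
    finally show ?thesis
      using A bor[OF A] by (simp add: measure_def)
  qed
  have cnt: "continuous_on UNIV (\<lambda>z. z / u)"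
    using u by (intro continuous_intros) auto
  have "(*) u ` S = (\<lambda>z. z / u) -` S"
  proof safe
    fix z assume "z / u \<in> S"
    moreover have "z = u * (z / u)" using u by auto
    ultimately show "z \<in> (*) u ` S" by blast
  qed (use u in auto)
  then have uS: "(*) u ` S \<in> sets borel"
    using measurable_sets_borel[OF borel_measurable_continuous_onI[OF cnt] S(1)] by simp
  let ?T = "\<lambda>v::real^2. ?f (u * ?g v)"
  have orth: "orthogonal_transformation ?T"
    unfolding orthogonal_transformation
  proof
    show "linear ?T"
      by (rule linearI) (auto simp: vec_eq_iff forall_2 algebra_simps)
    have nrm: "norm (?f z) = norm z" for z
      by (simp add: norm_vec_def L2_set_def UNIV_2 cmod_def)
    then show "\<forall>v. norm (?T v) = norm v"
      by (metis (no_types, lifting) fg mult_cancel_right2 norm_mult u)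
  qed
  have "measure lebesgue ((*) u ` S) = measure lebesgue (?f ` ((*) u ` S))"
    using pres[OF uS] by simp
  also have "?f ` ((*) u ` S) = ?T ` (?f ` S)"
    by (auto simp: image_image gf)
  also have "measure lebesgue \<dots> = measure lebesgue (?f ` S)"
  proof (rule measure_orthogonal_image[OF orth])
    have "bounded (?f ` S)"
    proof -
      have "linear ?f" by (rule linearI) (auto simp: vec_eq_iff forall_2)
      then show ?thesis
        using S(2) bounded_linear_image linear_conv_bounded_linear by blast
    qed
    then show "?f ` S \<in> lmeasurable"
      using bor[OF S(1)] by (intro bounded_set_imp_lmeasurable) auto
  qed
  also have "\<dots> = measure lebesgue S"
    by (rule pres[OF S(1)])
  finally show ?thesis .
qed

text \<open>Additivity gives the values at the rational multiples of \<open>P\<close>, monotonicity squeezes the rest.\<close>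

lemma additive_nonneg_imp_linear:
  fixes m :: "real \<Rightarrow> real"
  assumes nonneg: "\<And>x. 0 \<le> x \<Longrightarrow> x \<le> P \<Longrightarrow> 0 \<le> m x"
    and add: "\<And>x y. 0 \<le> x \<Longrightarrow> 0 \<le> y \<Longrightarrow> x + y \<le> P \<Longrightarrow> m (x + y) = m x + m y"
    and P: "P > 0" and x: "0 \<le> x" "x \<le> P"
  shows "m x = x / P * m P"
proof -
  have mono: "m a \<le> m b" if "0 \<le> a" "a \<le> b" "b \<le> P" for a b
    using add[of a "b - a"] nonneg[of "b - a"] that by auto
  have mult: "m (real k * h) = real k * m h" if "0 \<le> h" "real k * h \<le> P" for k h
    using that
  proof (induction k)
    case 0
    then show ?case using add[of 0 0] P by simp
  next
    case (Suc k)
    have "real k * h \<le> P" using Suc.prems by (auto simp: algebra_simps)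
    then show ?case
      using Suc add[of "real k * h" h] by (simp add: algebra_simps)
  qed
  have mP: "0 \<le> m P" using nonneg[of P] P by simp
  have frac: "m (real k / real n * P) = real k / real n * m P" if "0 < n" "k \<le> n" for k n
  proof -
    have "m (real n * (P / real n)) = real n * m (P / real n)"
      by (rule mult) (use P that in auto)
    then have 1: "m (P / real n) = m P / real n"
      using that by simp
    have "m (real k * (P / real n)) = real k * m (P / real n)"
      by (rule mult) (use P that in \<open>auto simp: field_simps\<close>)
    then show ?thesis using 1 by simp
  qed
  have close: "\<bar>m x - x / P * m P\<bar> \<le> m P / real n" if n: "0 < n" for n :: nat
  proof (cases "x = P")
    case True then show ?thesis using P mP by simp
  next
    case False
    define y where "y = x / P * real n"
    define k where "k = nat \<lfloor>y\<rfloor>"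
    have y: "0 \<le> y" "y < real n"
      using P x False n by (auto simp: y_def field_simps)
    then have k: "real k \<le> y" "y < real k + 1" "k + 1 \<le> n"
      unfolding k_def by linarith+
    have xP: "real k / real n * P \<le> x" "x \<le> real (k+1) / real n * P"
      using k P n by (auto simp: y_def field_simps)
    have "real (k+1) / real n * P \<le> P"
      using k(3) P n by (simp add: divide_le_eq mult_right_mono)
    then have "real k / real n * m P \<le> m x" "m x \<le> real (k+1) / real n * m P"
      using mono[OF _ xP(1)] mono[OF _ xP(2)] frac[OF n, of k] frac[OF n, of "k+1"] k(3) P x by auto
    moreover have "real k / real n \<le> x / P" "x / P \<le> real (k+1) / real n"
      using k P n by (auto simp: y_def field_simps)
    then have "real k / real n * m P \<le> x / P * m P" "x / P * m P \<le> real (k+1) / real n * m P"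
      using mP by (blast intro: mult_right_mono)+
    moreover have "real (k+1) / real n * m P = real k / real n * m P + m P / real n"
      by (simp add: add_divide_distrib algebra_simps)
    ultimately show ?thesis by linarith
  qed
  have "(\<lambda>n. m P / real n) \<longlonglongrightarrow> 0"
    by (rule lim_const_over_n)
  moreover have "\<forall>\<^sub>F n in sequentially. \<bar>m x - x / P * m P\<bar> \<le> m P / real n"
    using eventually_gt_at_top[of 0] by eventually_elim (rule close)
  ultimately have "\<bar>m x - x / P * m P\<bar> \<le> 0"
    by (rule tendsto_lowerbound) simp
  then show ?thesis by simp
qed

text \<open>Half-open in both coordinates, so that adjacent sectors are disjoint and a full turn is exactly
  an annulus.\<close>

definition sector :: "real \<Rightarrow> real \<Rightarrow> real \<Rightarrow> real \<Rightarrow> complex set" where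
  "sector r1 r2 a b = (\<lambda>(\<rho>, \<theta>). of_real \<rho> * cis \<theta>) ` ({r1<..r2} \<times> {a<..b})"

lemma sector_borel: "sector r1 r2 a b \<in> sets borel"
proof -
  let ?f = "\<lambda>(\<rho>, \<theta>). of_real \<rho> * cis \<theta>"
  let ?h = "\<lambda>n::nat. 1 / real (Suc n)"
  have half_open: "{x<..y} = (\<Union>n. {x + ?h n..y})" for x y :: real
  proof
    show "{x<..y} \<subseteq> (\<Union>n. {x + ?h n..y})"
    proof
      fix t assume t: "t \<in> {x<..y}"
      then obtain n where "inverse (real (Suc n)) < t - x"
        using reals_Archimedean[of "t - x"] by auto
      then show "t \<in> (\<Union>n. {x + ?h n..y})"
        using t by (auto simp: inverse_eq_divide intro!: exI[of _ n])
    qed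
  next
    show "(\<Union>n. {x + ?h n..y}) \<subseteq> {x<..y}"
    proof clarsimp
      fix t n assume "x + 1 / (1 + real n) \<le> t"
      moreover have "0 < 1 / (1 + real n)" by simp
      ultimately show "x < t" by linarith
    qed
  qed
  have "sector r1 r2 a b = (\<Union>n. \<Union>m. ?f ` ({r1 + ?h n..r2} \<times> {a + ?h m..b}))"
  proof -
    have "{r1<..r2} \<times> {a<..b} = (\<Union>n. \<Union>m. {r1 + ?h n..r2} \<times> {a + ?h m..b})"
      unfolding half_open[of r1 r2] half_open[of a b] by blast
    then show ?thesis
      unfolding sector_def by (simp only: image_UN)
  qed
  moreover have "?f ` ({r1 + ?h n..r2} \<times> {a + ?h m..b}) \<in> sets borel" for n m
  proof -
    have "compact (?f ` ({r1 + ?h n..r2} \<times> {a + ?h m..b}))"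
      by (intro compact_continuous_image compact_Times compact_Icc)
        (auto simp: case_prod_unfold intro!: continuous_intros)
    then show ?thesis by (simp add: borel_compact)
  qed
  ultimately show ?thesis by auto
qed

lemma bounded_sector: "0 \<le> r1 \<Longrightarrow> bounded (sector r1 r2 a b)"
  by (rule bounded_subset[of "cball 0 r2"]) (auto simp: sector_def norm_mult)

lemma sector_lmeasurable: "0 \<le> r1 \<Longrightarrow> sector r1 r2 a b \<in> lmeasurable"
  using sector_borel bounded_sector by (intro bounded_set_imp_lmeasurable) auto

lemma cis_inj:
  assumes "cis a = cis b" "\<bar>a - b\<bar> < 2 * pi"
  shows "a = b"
proof -
  have "cis (a - b) = 1"
    using assms(1) by (metis cis_divide cis_neq_zero divide_self)
  then have "Re (cis (a - b)) = 1" by simp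
  then obtain n :: int where n: "a - b = of_int n * (2 * pi)"
    by (auto simp: cos_one_2pi_int algebra_simps)
  have "\<bar>real_of_int n\<bar> * (2 * pi) < 1 * (2 * pi)"
    using assms(2) unfolding n by (simp add: abs_mult)
  then have "\<bar>real_of_int n\<bar> < 1" by (rule mult_right_less_imp_less) simp
  then have "n = 0" by linarith
  then show ?thesis using n by simp
qed

lemma sector_disjoint:
  assumes "0 \<le> r1" "b \<le> a'" "b' \<le> a + 2 * pi"
  shows "sector r1 r2 a b \<inter> sector r1 r2 a' b' = {}"
proof -
  have False if "of_real \<rho> * cis \<theta> = of_real \<rho>' * cis \<theta>'" "\<rho> > 0" "\<rho>' > 0" "a < \<theta>" "\<theta> \<le> b" "a' < \<theta>'" "\<theta>' \<le> b'" for \<rho> \<rho>' \<theta> \<theta>'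
  proof -
    have "norm (of_real \<rho> * cis \<theta>) = norm (of_real \<rho>' * cis \<theta>')" using that by simp
    then have "\<rho> = \<rho>'" using that(2,3) by (simp add: norm_mult)
    then have "cis \<theta> = cis \<theta>'" using that by simp
    then have "\<theta> = \<theta>'" by (rule cis_inj) (use that assms in linarith)
    then show False using that assms by linarith
  qed
  then show ?thesis using assms(1) by (fastforce simp: sector_def)
qed

text \<open>By rotation invariance the area depends on \<open>b - a\<close> only, and it is additive in that length; the
  constant is found from the full annulus.\<close>

lemma measure_sector:
  assumes r: "0 \<le> r1" "r1 \<le> r2" and ab: "a \<le> b" "b \<le> a + 2 * pi"
  shows "measure lebesgue (sector r1 r2 a b) = (b - a) * (r2\<^sup>2 - r1\<^sup>2) / 2"
proof -
  define m where "m x = measure lebesgue (sector r1 r2 0 x)" for x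
  have rot: "measure lebesgue (sector r1 r2 a (a + x)) = m x" for a x
  proof -
    have "sector r1 r2 a (a + x) = (*) (cis a) ` sector r1 r2 0 x"
    proof -
      have "{r1<..r2} \<times> {a<..a + x} = (\<lambda>(\<rho>, \<theta>). (\<rho>, a + \<theta>)) ` ({r1<..r2} \<times> {0<..x})"
      proof -
        have "{a<..a + x} = (+) a ` {0<..x}" by simp
        then show ?thesis by (subst image_paired_Times[of "\<lambda>x. x" "(+) a"]) simp
      qed
      then have "sector r1 r2 a (a + x) = (\<lambda>(\<rho>, \<theta>). of_real \<rho> * cis (a + \<theta>)) ` ({r1<..r2} \<times> {0<..x})"
        unfolding sector_def by (simp add: image_image case_prod_unfold)
      also have "\<dots> = (*) (cis a) ` sector r1 r2 0 x"
        unfolding sector_def image_image by (intro image_cong) (auto simp: cis_mult[symmetric])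
      finally show ?thesis .
    qed
    then show ?thesis
      unfolding m_def using measure_rotation_complex[OF _ sector_borel bounded_sector[OF r(1)], of "cis a"] by simp
  qed
  have add: "m (x + y) = m x + m y" if "0 \<le> x" "0 \<le> y" "x + y \<le> 2 * pi" for x y
  proof -
    have "{0<..x + y} = {0<..x} \<union> {x<..x + y}" using that by auto
    then have "sector r1 r2 0 (x + y) = sector r1 r2 0 x \<union> sector r1 r2 x (x + y)"
      unfolding sector_def by (auto simp: Sigma_Un_distrib2)
    moreover have "sector r1 r2 0 x \<inter> sector r1 r2 x (x + y) = {}"
      using that r by (intro sector_disjoint) auto
    ultimately have "m (x + y) = m x + measure lebesgue (sector r1 r2 x (x + y))"
      unfolding m_def using sector_lmeasurable[OF r(1)] by (simp add: measure_Un3)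
    then show ?thesis using rot[of x y] by simp
  qed
  have full: "m (2 * pi) = pi * (r2\<^sup>2 - r1\<^sup>2)"
  proof -
    have "sector r1 r2 0 (2 * pi) = cball 0 r2 - cball 0 r1"
    proof
      show "sector r1 r2 0 (2 * pi) \<subseteq> cball 0 r2 - cball 0 r1"
        using r by (auto simp: sector_def norm_mult)
      show "cball 0 r2 - cball 0 r1 \<subseteq> sector r1 r2 0 (2 * pi)"
      proof
        fix z :: complex assume z: "z \<in> cball 0 r2 - cball 0 r1"
        have "\<exists>\<theta>. 0 < \<theta> \<and> \<theta> \<le> 2 * pi \<and> z = of_real (norm z) * cis \<theta>"
        proof (cases "Arg2pi z = 0")
          case True
          then have "z = of_real (norm z) * cis (2 * pi)"
            using Arg2pi[of z] unfolding is_Arg_def by (metis cis_2pi cis_conv_exp cis_zero of_real_0)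
          moreover have "0 < 2 * pi" "2 * pi \<le> 2 * pi" by simp_all
          ultimately show ?thesis by blast
        next
          case False
          then have "0 < Arg2pi z" "Arg2pi z \<le> 2 * pi"
            using Arg2pi[of z] by (auto simp: order_less_le)
          moreover have "z = of_real (norm z) * cis (Arg2pi z)"
            using Arg2pi[of z] unfolding is_Arg_def cis_conv_exp by blast
          ultimately show ?thesis by blast
        qed
        then obtain \<theta> where "\<theta> \<in> {0<..2 * pi}" "z = of_real (norm z) * cis \<theta>" by auto
        moreover have "norm z \<in> {r1<..r2}" using z by auto
        ultimately show "z \<in> sector r1 r2 0 (2 * pi)"
          unfolding sector_def by (intro image_eqI[of _ _ "(norm z, \<theta>)"]) (simp_all only: case_prod_conv mem_Sigma_iff)
      qed
    qed
    then have "m (2 * pi) = measure lebesgue (cball 0 r2 - cball 0 r1 :: complex set)"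
      by (simp add: m_def)
    also have "\<dots> = measure lebesgue (cball 0 r2 :: complex set) - measure lebesgue (cball 0 r1 :: complex set)"
      using r by (intro measurable_measure_Diff) auto
    also have "\<dots> = pi * (r2\<^sup>2 - r1\<^sup>2)"
      using r by (simp add: content_cball unit_ball_vol_2 algebra_simps)
    finally show ?thesis .
  qed
  have "m (b - a) = (b - a) / (2 * pi) * m (2 * pi)"
    by (rule additive_nonneg_imp_linear) (use ab add in \<open>auto simp: m_def\<close>)
  then show ?thesis
    using rot[of a "b - a"] by (simp add: full)
qed

section \<open>Curves that meet small circles around their points transversally\<close>

lemma periodic_int:
  fixes f :: "real \<Rightarrow> 'a"
  assumes "\<And>s. f (s + L) = f s"
  shows "f (s + of_int n * L) = f s"
proof -
  have nat: "f (s + of_nat m * L) = f s" for m s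
  proof (induction m)
    case (Suc m)
    then show ?case using assms[of "s + of_nat m * L"] by (simp add: algebra_simps)
  qed simp
  show ?thesis
    using nat[of s "nat n"] nat[of "s + of_int n * L" "nat (- n)"] by (cases "0 \<le> n") auto
qed

lemma shift_into_period:
  fixes s L :: real
  assumes "0 < L"
  obtains n :: int where "0 \<le> s + of_int n * L" "s + of_int n * L < L"
proof -
  define m where "m = \<lfloor>s / L\<rfloor>"
  have "of_int m \<le> s / L" "s / L < of_int m + 1"
    unfolding m_def by linarith+
  then have "of_int m * L \<le> s" "s < of_int m * L + L"
    using assms by (auto simp: field_simps)
  then show thesis by (intro that[of "- m"]) auto
qed

text \<open>
  An arclength parametrization with derivatives \<open>c'\<close> and \<open>c''\<close> of a simple closed curve that meets no
  normal line of its own a second time within distance \<open>R\<close> of the foot point. For \<open>R \<le> 0\<close> this last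
  condition is void, so plain \<open>C\<^sup>2\<close> simple closed curves are instances.
\<close>

locale transverse_curve =
  fixes c c' c'' :: "real \<Rightarrow> complex" and L R :: real
  assumes L_pos: "0 < L"
    and c_deriv: "\<And>s. (c has_vector_derivative c' s) (at s)"
    and c'_deriv: "\<And>s. (c' has_vector_derivative c'' s) (at s)"
    and speed: "\<And>s. norm (c' s) = 1"
    and period: "\<And>s. c (s + L) = c s"
    and simple: "\<And>s t. 0 < t \<Longrightarrow> t < L \<Longrightarrow> c (s + t) \<noteq> c s"
    and transverse: "\<And>s t. c t \<noteq> c s \<Longrightarrow> norm (c t - c s) < R \<Longrightarrow> c' s \<bullet> (c t - c s) \<noteq> 0"
begin

lemma has_derivative_c [derivative_intros]:
  assumes "(f has_derivative f') (at x within S)"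
  shows "((\<lambda>x. c (f x)) has_derivative (\<lambda>h. f' h *\<^sub>R c' (f x))) (at x within S)"
  using has_derivative_compose[OF assms c_deriv[of "f x", unfolded has_vector_derivative_def]] .

lemma has_derivative_c' [derivative_intros]:
  assumes "(f has_derivative f') (at x within S)"
  shows "((\<lambda>x. c' (f x)) has_derivative (\<lambda>h. f' h *\<^sub>R c'' (f x))) (at x within S)"
  using has_derivative_compose[OF assms c'_deriv[of "f x", unfolded has_vector_derivative_def]] .

lemma continuous_on_c: "continuous_on UNIV c" and continuous_on_c': "continuous_on UNIV c'"
  using c_deriv c'_deriv
  by (auto simp: continuous_on_eq_continuous_at intro: has_vector_derivative_continuous)

lemmas continuous_intros_c [continuous_intros] =
  continuous_on_compose2[OF continuous_on_c] continuous_on_compose2[OF continuous_on_c']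

definition chord :: "real \<Rightarrow> real \<Rightarrow> complex" where "chord s t = c (s + t) - c s"

text \<open>The velocity at which the end point of the chord leaves the circle around its starting point,
  multiplied by the length of the chord.\<close>

definition departure :: "real \<Rightarrow> real \<Rightarrow> real" where
  "departure s t = chord s t \<bullet> c' (s + t)"

lemma chord_0 [simp]: "chord s 0 = 0" and chord_L [simp]: "chord s L = 0"
  by (simp_all add: chord_def period)

lemma chord_nonzero: "0 < t \<Longrightarrow> t < L \<Longrightarrow> chord s t \<noteq> 0"
  using simple[of t s] by (simp add: chord_def)

text \<open>Transversality at the end point of the chord rather than at its starting point.\<close>

lemma departure_nonzero: "0 < t \<Longrightarrow> t < L \<Longrightarrow> norm (chord s t) < R \<Longrightarrow> departure s t \<noteq> 0"
  using transverse[of s "s + t"] simple[of t s]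
  by (auto simp: departure_def chord_def inner_commute inner_diff_right norm_minus_commute)

lemma advance_nonzero: "0 < t \<Longrightarrow> t < L \<Longrightarrow> norm (chord s t) < R \<Longrightarrow> c' s \<bullet> chord s t \<noteq> 0"
  using transverse[of "s + t" s] simple[of t s] by (auto simp: chord_def)

lemma norm_chord_deriv:
  "((\<lambda>t. (norm (chord s t))\<^sup>2) has_real_derivative 2 * departure s t) (at t)"
  unfolding chord_def departure_def has_field_derivative_def power2_norm_eq_inner
  by (auto intro!: derivative_eq_intros simp: inner_commute fun_eq_iff algebra_simps)

lemma continuous_on_departure: "continuous_on UNIV (\<lambda>(s, t). departure s t)"
  unfolding chord_def departure_def case_prod_unfold by (auto intro!: continuous_intros)

lemma continuous_on_chord_right: "continuous_on S (chord s)"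
  unfolding chord_def by (auto intro!: continuous_intros)

text \<open>An interior minimum of the distance from \<open>c s\<close> would be a critical point.\<close>

lemma norm_chord_no_interior_dip:
  assumes "0 \<le> t1" "t1 < x" "x < t2" "t2 \<le> L"
    and "norm (chord s x) < norm (chord s t1)" "norm (chord s x) < norm (chord s t2)"
    and "norm (chord s x) < R"
  shows False
proof -
  have "continuous_on {t1..t2} (\<lambda>t. norm (chord s t))"
    using continuous_on_chord_right by (intro continuous_intros)
  then obtain m where m: "m \<in> {t1..t2}" "\<And>t. t \<in> {t1..t2} \<Longrightarrow> norm (chord s m) \<le> norm (chord s t)"
    using continuous_attains_inf[of "{t1..t2}" "\<lambda>t. norm (chord s t)"] assms by auto
  have mx: "norm (chord s m) \<le> norm (chord s x)" using m(2)[of x] assms by auto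
  have "m \<noteq> t1" "m \<noteq> t2" using mx assms by auto
  then have m12: "t1 < m" "m < t2" using m(1) by auto
  have "2 * departure s m = 0"
  proof (rule DERIV_local_min[OF norm_chord_deriv])
    show "0 < min (m - t1) (t2 - m)" using m12 by simp
    show "\<forall>y. \<bar>m - y\<bar> < min (m - t1) (t2 - m) \<longrightarrow> (norm (chord s m))\<^sup>2 \<le> (norm (chord s y))\<^sup>2"
    proof (intro allI impI power_mono m(2))
      fix y assume "\<bar>m - y\<bar> < min (m - t1) (t2 - m)"
      then show "y \<in> {t1..t2}" unfolding atLeastAtMost_iff by linarith
    qed simp
  qed
  then show False
    using departure_nonzero[of m s] m12 assms mx by auto
qed

lemma shorter_before:
  assumes "departure s t > 0" "0 < e"
  shows "\<exists>x. t - e < x \<and> x < t \<and> norm (chord s x) < norm (chord s t)"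
proof -
  obtain d where d: "d > 0" "\<And>h. 0 < h \<Longrightarrow> h < d \<Longrightarrow> (norm (chord s (t - h)))\<^sup>2 < (norm (chord s t))\<^sup>2"
    using DERIV_pos_inc_left[OF norm_chord_deriv[of s t]] assms by auto
  define h where "h = min d e / 2"
  have "0 < h" "h < d" "h < e" using d(1) assms by (auto simp: h_def)
  then show ?thesis
    using d(2)[of h] by (intro exI[of _ "t - h"]) (auto intro: power_less_imp_less_base)
qed

text \<open>Between two exits through the same circle the curve would have to dip back into the disk.\<close>

lemma exit_unique:
  assumes "0 < t1" "t1 < L" "departure s t1 > 0" "0 < t2" "t2 < L" "departure s t2 > 0"
    and "norm (chord s t1) = \<rho>" "norm (chord s t2) = \<rho>" "\<rho> < R"
  shows "t1 = t2"
proof -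
  have False if ab: "0 < a" "a < b" "b < L" "departure s b > 0" "norm (chord s a) = \<rho>" "norm (chord s b) = \<rho>" for a b
  proof -
    obtain x where "b - (b - a) < x" "x < b" "norm (chord s x) < \<rho>"
      using shorter_before[of s b "b - a"] ab by auto
    then show False
      using norm_chord_no_interior_dip[of a x b s] ab assms by auto
  qed
  from this[of t1 t2] this[of t2 t1] show ?thesis
    using assms by (cases t1 t2 rule: linorder_cases) auto
qed

text \<open>The farthest point from \<open>c s\<close> is a critical point of the distance.\<close>

lemma far_point: "\<exists>t. 0 < t \<and> t < L \<and> R \<le> norm (chord s t)"
proof -
  have "continuous_on {0..L} (\<lambda>t. norm (chord s t))"
    using continuous_on_chord_right by (intro continuous_intros)
  then obtain m where m: "m \<in> {0..L}" "\<And>t. t \<in> {0..L} \<Longrightarrow> norm (chord s t) \<le> norm (chord s m)"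
    using continuous_attains_sup[of "{0..L}" "\<lambda>t. norm (chord s t)"] L_pos by auto
  have "0 < norm (chord s m)"
    using m(2)[of "L / 2"] chord_nonzero[of "L / 2" s] L_pos by auto
  then have "m \<noteq> 0" "m \<noteq> L" by auto
  then have m0: "0 < m" "m < L" using m(1) by auto
  have "2 * departure s m = 0"
  proof (rule DERIV_local_max[OF norm_chord_deriv])
    show "0 < min m (L - m)" using m0 by simp
    show "\<forall>y. \<bar>m - y\<bar> < min m (L - m) \<longrightarrow> (norm (chord s y))\<^sup>2 \<le> (norm (chord s m))\<^sup>2"
    proof (intro allI impI power_mono m(2))
      fix y assume "\<bar>m - y\<bar> < min m (L - m)"
      then show "y \<in> {0..L}" unfolding atLeastAtMost_iff by linarith
    qed simp
  qed
  then show ?thesis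
    using departure_nonzero[of m s] m0 by force
qed

text \<open>The first parameter at which the distance \<open>\<rho>\<close> is reached is an exit.\<close>

lemma exit_exists:
  assumes "0 < \<rho>" "\<rho> < R"
  shows "\<exists>t. 0 < t \<and> t < L \<and> norm (chord s t) = \<rho> \<and> departure s t > 0"
proof -
  obtain t0 where t0: "0 < t0" "t0 < L" "R \<le> norm (chord s t0)" using far_point by blast
  define S where "S = {t \<in> {0..t0}. \<rho> \<le> norm (chord s t)}"
  have "S = {0..t0} \<inter> (\<lambda>t. norm (chord s t)) -` {\<rho>..}" by (auto simp: S_def)
  moreover have "closed ({0..t0} \<inter> (\<lambda>t. norm (chord s t)) -` {\<rho>..})"
    using continuous_on_chord_right by (intro continuous_on_closed_vimage[THEN iffD1, rule_format] continuous_intros continuous_closed_preimage) auto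
  ultimately have "compact S"
    by (metis S_def bounded_closed_interval bounded_subset compact_eq_bounded_closed inf_le1)
  moreover have "t0 \<in> S" using t0 assms by (auto simp: S_def)
  ultimately obtain t where t: "t \<in> S" "\<And>x. x \<in> S \<Longrightarrow> t \<le> x"
    using compact_attains_inf[of S] by blast
  have before: "norm (chord s x) < \<rho>" if "0 \<le> x" "x < t" for x
    using t(2)[of x] t(1) that by (force simp: S_def)
  have "t \<noteq> 0" using t(1) assms by (auto simp: S_def)
  then have tpos: "0 < t" "t < L" using t(1) t0 by (auto simp: S_def)
  have eq: "norm (chord s t) = \<rho>"
  proof (rule ccontr)
    assume "norm (chord s t) \<noteq> \<rho>"
    then have "\<rho> < norm (chord s t)" using t(1) by (auto simp: S_def)
    moreover have "continuous_on {0..t} (\<lambda>t. norm (chord s t))"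
      using continuous_on_chord_right by (intro continuous_intros)
    ultimately obtain x where "0 \<le> x" "x \<le> t" "norm (chord s x) = \<rho>"
      using IVT'[of "\<lambda>t. norm (chord s t)" 0 \<rho> t] assms tpos by auto
    then show False using before[of x] \<open>\<rho> < norm (chord s t)\<close> by (cases "x = t") auto
  qed
  have "\<not> departure s t < 0"
  proof
    assume "departure s t < 0"
    then obtain d where d: "d > 0" "\<And>h. 0 < h \<Longrightarrow> h < d \<Longrightarrow> (norm (chord s t))\<^sup>2 < (norm (chord s (t - h)))\<^sup>2"
      using DERIV_neg_dec_left[OF norm_chord_deriv[of s t]] by auto
    define h where "h = min d t / 2"
    have h: "0 < h" "h < d" "h < t" using d(1) tpos by (auto simp: h_def)
    then have "\<rho> < norm (chord s (t - h))"
      using d(2)[of h] eq by (auto intro: power_less_imp_less_base)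
    then show False using before[of "t - h"] h by auto
  qed
  moreover have "departure s t \<noteq> 0"
    using departure_nonzero[of t s] tpos eq assms by auto
  ultimately show ?thesis using tpos eq by (intro exI[of _ t]) auto
qed

definition exit_time :: "real \<Rightarrow> real \<Rightarrow> real" where
  "exit_time s \<rho> = (THE t. 0 < t \<and> t < L \<and> norm (chord s t) = \<rho> \<and> departure s t > 0)"

lemma exit_time_eqI:
  assumes "0 < t" "t < L" "norm (chord s t) = \<rho>" "departure s t > 0" "\<rho> < R"
  shows "exit_time s \<rho> = t"
  unfolding exit_time_def
proof (rule the_equality)
  fix x assume "0 < x \<and> x < L \<and> norm (chord s x) = \<rho> \<and> departure s x > 0"
  then show "x = t" by (intro exit_unique[of x s t \<rho>]) (use assms in auto)
qed (use assms in auto)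

lemma exit_time:
  assumes "0 < \<rho>" "\<rho> < R"
  shows "0 < exit_time s \<rho>" "exit_time s \<rho> < L" "norm (chord s (exit_time s \<rho>)) = \<rho>"
    "departure s (exit_time s \<rho>) > 0"
proof -
  obtain t where t: "0 < t" "t < L" "norm (chord s t) = \<rho>" "departure s t > 0"
    using exit_exists[OF assms] by blast
  with exit_time_eqI[OF t assms(2)]
  show "0 < exit_time s \<rho>" "exit_time s \<rho> < L" "norm (chord s (exit_time s \<rho>)) = \<rho>"
    "departure s (exit_time s \<rho>) > 0"
    by simp_all
qed

lemma advance_deriv:
  "((\<lambda>t. c' s \<bullet> chord s t) has_real_derivative c' s \<bullet> c' (s + t)) (at t)"
  unfolding chord_def has_field_derivative_def
  by (auto intro!: derivative_eq_intros simp: fun_eq_iff algebra_simps)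

text \<open>The curve starts in the direction of the tangent, and up to the exit it does not meet the normal
  line at \<open>c s\<close> again.\<close>

lemma exit_advance_pos:
  assumes \<rho>: "0 < \<rho>" "\<rho> < R"
  shows "c' s \<bullet> chord s (exit_time s \<rho>) > 0"
proof -
  define T where "T = exit_time s \<rho>"
  note T = exit_time[OF \<rho>, of s, folded T_def]
  have "c' s \<bullet> c' (s + 0) > 0"
    using speed[of s] by (simp add: norm_eq_1)
  then obtain d where d: "d > 0" "\<And>h. 0 < h \<Longrightarrow> h < d \<Longrightarrow> 0 < c' s \<bullet> chord s h"
    using DERIV_pos_inc_right[OF advance_deriv[of s 0]] by auto
  have short: "norm (chord s t) < R" if t: "0 < t" "t \<le> T" for t
  proof (rule ccontr)
    assume far: "\<not> norm (chord s t) < R"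
    then have "t < T" using T \<rho> t by (cases "t = T") auto
    then obtain x where "T - (T - t) < x" "x < T" "norm (chord s x) < \<rho>"
      using shorter_before[of s T "T - t"] T by auto
    then show False
      using norm_chord_no_interior_dip[of t x T s] t T far \<rho> by auto
  qed
  show ?thesis
  proof (rule ccontr)
    assume neg: "\<not> ?thesis"
    define h where "h = min d T / 2"
    have h: "0 < h" "h < d" "h < T" using d(1) T by (auto simp: h_def)
    have "continuous_on {h..T} (\<lambda>t. c' s \<bullet> chord s t)"
      using continuous_on_chord_right by (intro continuous_intros)
    then obtain x where "h \<le> x" "x \<le> T" "c' s \<bullet> chord s x = 0"
      using IVT2'[of "\<lambda>t. c' s \<bullet> chord s t" T 0 h] neg d(2)[of h] h by (auto simp: T_def)
    then show False
      using advance_nonzero[of x s] short[of x] h T by auto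
  qed
qed

text \<open>For nearby data the intermediate value theorem provides an exit near the old one, and exits are
  unique.\<close>

lemma continuous_exit_time:
  assumes \<rho>: "0 < \<rho>" "\<rho> < R"
  shows "continuous (at (s, \<rho>)) (\<lambda>(s, \<rho>). exit_time s \<rho>)"
proof -
  define T where "T = exit_time s \<rho>"
  note T = exit_time[OF \<rho>, of s, folded T_def]
  have "\<forall>\<^sub>F z in at (s, \<rho>). \<bar>exit_time (fst z) (snd z) - T\<bar> < e" if e: "0 < e" for e
  proof -
    have "open ((\<lambda>(s, t). departure s t) -` {0<..})"
      using continuous_on_departure by (intro open_vimage) auto
    then obtain d where d: "d > 0" "ball (s, T) d \<subseteq> (\<lambda>(s, t). departure s t) -` {0<..}"
      using T(4) by (metis (no_types, lifting) case_prod_conv greaterThan_iff openE vimageI)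
    have dep: "departure x t > 0" if "\<bar>x - s\<bar> < d / 2" "\<bar>t - T\<bar> < d / 2" for x t
    proof -
      have "dist (s, T) (x, t) \<le> \<bar>x - s\<bar> + \<bar>t - T\<bar>"
        using norm_Pair_le[of "s - x" "T - t"] by (simp add: dist_norm abs_minus_commute)
      then have "(x, t) \<in> ball (s, T) d" using that by auto
      then show ?thesis using d(2) by auto
    qed
    define h where "h = min (min (d / 4) (e / 2)) (min (T / 2) ((L - T) / 2))"
    have h: "0 < h" "h < d / 2" "h < e" "h < T" "h < L - T"
      using d(1) e T(1,2) by (auto simp: h_def min_less_iff_disj min_mult_distrib_left)
    have incr: "norm (chord s a) < norm (chord s b)" if "T - h \<le> a" "a < b" "b \<le> T + h" for a b
    proof -
      have "(norm (chord s a))\<^sup>2 < (norm (chord s b))\<^sup>2"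
      proof (rule DERIV_pos_imp_increasing[OF that(2)])
        fix x assume "a \<le> x" "x \<le> b"
        then have "\<bar>x - T\<bar> < d / 2" using that h(2) by linarith
        then have "departure s x > 0" using dep[of s x] d(1) by simp
        then show "\<exists>y. ((\<lambda>t. (norm (chord s t))\<^sup>2) has_real_derivative y) (at x) \<and> 0 < y"
          using norm_chord_deriv[of s x] by (intro exI[of _ "2 * departure s x"]) auto
      qed
      then show ?thesis by (rule power_less_imp_less_base) simp
    qed
    have cont: "continuous_on UNIV (\<lambda>z. norm (chord (fst z) t))" for t
      unfolding chord_def by (intro continuous_intros) auto
    have lim1: "((\<lambda>z. norm (chord (fst z) t)) \<longlongrightarrow> norm (chord s t)) (at (s, \<rho>))" for t
      using cont[of t, unfolded continuous_on_def, rule_format, of "(s, \<rho>)"] by simp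
    have lim2: "((\<lambda>z. snd z) \<longlongrightarrow> \<rho>) (at (s, \<rho>))" and lim3: "((\<lambda>z. fst z) \<longlongrightarrow> s) (at (s, \<rho>))"
      using tendsto_snd[OF tendsto_ident_at, of "(s, \<rho>)" UNIV] tendsto_fst[OF tendsto_ident_at, of "(s, \<rho>)" UNIV] by auto
    have "\<forall>\<^sub>F z in at (s, \<rho>). norm (chord (fst z) (T - h)) - snd z < 0"
      using incr[of "T - h" T] h T(3) by (intro order_tendstoD(2)[OF tendsto_diff[OF lim1 lim2]]) auto
    moreover have "\<forall>\<^sub>F z in at (s, \<rho>). norm (chord (fst z) (T + h)) - snd z > 0"
      using incr[of T "T + h"] h T(3) by (intro order_tendstoD(1)[OF tendsto_diff[OF lim1 lim2]]) auto
    moreover have "\<forall>\<^sub>F z in at (s, \<rho>). snd z < R"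
      by (rule order_tendstoD(2)[OF lim2 \<rho>(2)])
    moreover have "\<forall>\<^sub>F z in at (s, \<rho>). \<bar>fst z - s\<bar> < d / 2"
      using tendstoD[OF lim3, of "d / 2"] d(1) by (simp add: dist_real_def)
    ultimately show ?thesis
    proof eventually_elim
      case (elim z)
      have "continuous_on {T - h..T + h} (\<lambda>t. norm (chord (fst z) t))"
        using continuous_on_chord_right by (intro continuous_intros)
      then obtain t where t: "T - h \<le> t" "t \<le> T + h" "norm (chord (fst z) t) = snd z"
        using IVT'[of "\<lambda>t. norm (chord (fst z) t)" "T - h" "snd z" "T + h"] elim h by auto
      have "\<bar>t - T\<bar> < d / 2" using t(1,2) h(2) by linarith
      then have "departure (fst z) t > 0" using dep[of "fst z" t] elim(4) by simp
      then have "exit_time (fst z) (snd z) = t"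
        using t h elim by (intro exit_time_eqI) auto
      then show ?case using t h by auto
    qed
  qed
  then show ?thesis
    unfolding continuous_def case_prod_unfold
    by (intro tendstoI) (simp add: T_def dist_real_def Lim_ident_at)
qed

text \<open>The map \<open>(s, \<rho>) \<mapsto> (s, exit_time s \<rho>)\<close> is a continuous right inverse of
  \<open>(s, t) \<mapsto> (s, \<bar>chord s t\<bar>)\<close>, whose derivative is invertible where \<open>departure s t \<noteq> 0\<close>.\<close>

lemma has_derivative_exit_time:
  fixes s :: real
  assumes \<rho>: "0 < \<rho>" "\<rho> < R"
  defines "T \<equiv> exit_time s \<rho>"
  shows "((\<lambda>(s, \<rho>). exit_time s \<rho>) has_derivative
      (\<lambda>(ds, d\<rho>). (\<rho> * d\<rho> - (chord s T \<bullet> (c' (s + T) - c' s)) * ds) / departure s T)) (at (s, \<rho>))"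
proof -
  note T = exit_time[OF \<rho>, of s, folded T_def]
  define N where "N = chord s T \<bullet> (c' (s + T) - c' s)"
  let ?f = "\<lambda>z. (fst z, norm (chord (fst z) (snd z)))"
  let ?f' = "\<lambda>z. (fst z, (N * fst z + departure s T * snd z) / \<rho>)"
  let ?g = "\<lambda>z. (fst z, exit_time (fst z) (snd z))"
  let ?g' = "\<lambda>z. (fst z, (\<rho> * snd z - N * fst z) / departure s T)"
  have "chord s T \<noteq> 0" using T(3) \<rho> by auto
  have "((\<lambda>z. chord (fst z) (snd z)) has_derivative
      (\<lambda>z. (fst z + snd z) *\<^sub>R c' (s + T) - fst z *\<^sub>R c' s)) (at (s, T))"
    unfolding chord_def by (auto intro!: derivative_eq_intros)
  then have "((\<lambda>z. norm (chord (fst z) (snd z))) has_derivative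
      (\<lambda>z. ((fst z + snd z) *\<^sub>R c' (s + T) - fst z *\<^sub>R c' s) \<bullet> sgn (chord s T))) (at (s, T))"
    using has_derivative_compose[of "\<lambda>z. chord (fst z) (snd z)" _ "(s, T)" UNIV norm "\<lambda>h. h \<bullet> sgn (chord s T)"]
      has_derivative_norm[OF \<open>chord s T \<noteq> 0\<close>] by simp
  then have "(?f has_derivative (\<lambda>z. (fst z,
      ((fst z + snd z) *\<^sub>R c' (s + T) - fst z *\<^sub>R c' s) \<bullet> sgn (chord s T)))) (at (s, T))"
    by (intro has_derivative_Pair has_derivative_fst has_derivative_ident)
  moreover have "((a + b) *\<^sub>R c' (s + T) - a *\<^sub>R c' s) \<bullet> sgn (chord s T) = (N * a + departure s T * b) / \<rho>" for a b
    using T(3) \<rho> by (simp add: N_def departure_def sgn_div_norm inner_commute inner_diff inner_add field_simps)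
  ultimately have f: "(?f has_derivative ?f') (at (?g (s, \<rho>)))"
    by (simp add: T_def[symmetric])
  have "(?g has_derivative ?g') (at (s, \<rho>))"
  proof (rule has_derivative_inverse_basic[where f = ?f and g = ?g and y = "(s, \<rho>)", OF f])
    show "bounded_linear ?g'"
      unfolding linear_conv_bounded_linear[symmetric]
      by (rule linearI) (auto simp: algebra_simps add_divide_distrib diff_divide_distrib)
    show "?g' \<circ> ?f' = id"
      using T(4) \<rho> by (auto simp: fun_eq_iff field_simps)
    show "continuous (at (s, \<rho>)) ?g"
      using continuous_exit_time[OF \<rho>, of s] by (auto intro!: continuous_intros simp: case_prod_unfold)
    show "open (UNIV \<times> {0<..<R})" by (intro open_Times) auto
    show "(s, \<rho>) \<in> UNIV \<times> {0<..<R}" using \<rho> by auto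
    show "?f (?g z) = z" if "z \<in> UNIV \<times> {0<..<R}" for z
      using exit_time(3)[of "snd z" "fst z"] that by (auto simp: prod_eq_iff)
  qed
  from has_derivative_snd[OF this] show ?thesis
    by (simp add: case_prod_unfold N_def)
qed

lemma exit_time_deriv_radius:
  assumes \<rho>: "0 < \<rho>" "\<rho> < R"
  shows "(exit_time s has_real_derivative \<rho> / departure s (exit_time s \<rho>)) (at \<rho>)"
proof -
  have "((\<lambda>x. (s, x)) has_derivative (\<lambda>h. (0, h))) (at \<rho>)"
    by (auto intro!: derivative_eq_intros)
  from has_derivative_compose[OF this has_derivative_exit_time[OF \<rho>, of s]]
  have "(exit_time s has_derivative (\<lambda>h. \<rho> * h / departure s (exit_time s \<rho>))) (at \<rho>)" by simp
  then show ?thesis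
    unfolding has_field_derivative_def by (rule has_derivative_eq_rhs) (simp add: fun_eq_iff)
qed

lemma exit_time_deriv_base:
  fixes s :: real
  assumes \<rho>: "0 < \<rho>" "\<rho> < R"
  defines "T \<equiv> exit_time s \<rho>"
  shows "((\<lambda>s. exit_time s \<rho>) has_real_derivative - (chord s T \<bullet> (c' (s + T) - c' s)) / departure s T) (at s)"
proof -
  have "((\<lambda>x. (x, \<rho>)) has_derivative (\<lambda>h. (h, 0))) (at s)"
    by (auto intro!: derivative_eq_intros)
  from has_derivative_compose[OF this has_derivative_exit_time[OF \<rho>, of s]]
  have "((\<lambda>s. exit_time s \<rho>) has_derivative
      (\<lambda>h. - ((chord s T \<bullet> (c' (s + T) - c' s)) * h) / departure s T)) (at s)" by (simp add: T_def)
  then show ?thesis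
    unfolding has_field_derivative_def by (rule has_derivative_eq_rhs) (simp add: fun_eq_iff)
qed

text \<open>The chord to the exit point, seen in the moving frame whose first axis is the tangent.\<close>

definition exit_vector :: "real \<Rightarrow> real \<Rightarrow> complex" where
  "exit_vector s \<rho> = cnj (c' s) * chord s (exit_time s \<rho>)"

definition exit_angle :: "real \<Rightarrow> real \<Rightarrow> real" where
  "exit_angle s \<rho> = Im (Ln (exit_vector s \<rho>))"

definition curvature :: "real \<Rightarrow> real" where
  "curvature s = Im (cnj (c' s) * c'' s)"

lemma c'_unit: "cnj (c' s) * c' s = 1" "c' s * cnj (c' s) = 1"
  using speed[of s] complex_norm_square[of "c' s"] by (simp_all add: mult.commute)

lemma c''_eq: "c'' s = \<i> * curvature s * c' s"
proof -
  have "((\<lambda>s. c' s \<bullet> c' s) has_real_derivative 2 * (c' s \<bullet> c'' s)) (at s)"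
    unfolding has_field_derivative_def
    by (auto intro!: derivative_eq_intros simp: inner_commute fun_eq_iff)
  moreover have "(\<lambda>s. c' s \<bullet> c' s) = (\<lambda>s. 1)"
    using speed by (simp add: norm_eq_1 fun_eq_iff)
  ultimately have "c' s \<bullet> c'' s = 0"
    using DERIV_unique[OF _ DERIV_const] by fastforce
  then have "Re (cnj (c' s) * c'' s) = 0"
    by (simp add: inner_complex_def)
  then have "cnj (c' s) * c'' s = \<i> * curvature s"
    by (simp add: complex_eq_iff curvature_def)
  then have "c' s * cnj (c' s) * c'' s = c' s * (\<i> * curvature s)"
    by (simp add: mult.assoc)
  then show ?thesis
    by (simp add: c'_unit mult.commute)
qed

lemma exit_vector:
  assumes \<rho>: "0 < \<rho>" "\<rho> < R"
  shows "norm (exit_vector s \<rho>) = \<rho>" "Re (exit_vector s \<rho>) > 0"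
  using exit_time(3)[OF \<rho>, of s] exit_advance_pos[OF \<rho>, of s] speed[of s]
  by (auto simp: exit_vector_def norm_mult inner_complex_def)

lemma exit_angle_bounds:
  assumes \<rho>: "0 < \<rho>" "\<rho> < R"
  shows "\<bar>exit_angle s \<rho>\<bar> < pi / 2"
proof -
  have "exit_vector s \<rho> \<noteq> 0" using exit_vector(1)[OF \<rho>, of s] \<rho> by auto
  then show ?thesis
    using exit_vector(2)[OF \<rho>, of s] Re_Ln_pos_lt[of "exit_vector s \<rho>"] by (auto simp: exit_angle_def)
qed

lemma exit_vector_polar:
  assumes \<rho>: "0 < \<rho>" "\<rho> < R"
  shows "exit_vector s \<rho> = of_real \<rho> * cis (exit_angle s \<rho>)"
proof -
  have nz: "exit_vector s \<rho> \<noteq> 0" using exit_vector(1)[OF \<rho>, of s] \<rho> by auto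
  then have "exit_vector s \<rho> = exp (Ln (exit_vector s \<rho>))" by simp
  also have "Ln (exit_vector s \<rho>) = of_real (ln \<rho>) + \<i> * exit_angle s \<rho>"
    using nz exit_vector(1)[OF \<rho>, of s] by (simp add: complex_eq_iff exit_angle_def)
  also have "exp \<dots> = of_real \<rho> * cis (exit_angle s \<rho>)"
    using \<rho> by (simp add: exp_add cis_conv_exp exp_of_real)
  finally show ?thesis .
qed

text \<open>The chain rule for \<open>exit_angle\<close>, for an arbitrary variable \<open>x\<close> so that it serves both the radius
  and the base point.\<close>

lemma exit_angle_deriv:
  assumes \<rho>: "0 < \<rho>" "\<rho> < R"
    and e: "exit_vector s \<rho> = f x" and f: "(f has_vector_derivative f') (at x)"
  shows "((\<lambda>x. Im (Ln (f x))) has_real_derivative Im (f' / exit_vector s \<rho>)) (at x)"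
proof -
  have "f x \<notin> \<real>\<^sub>\<le>\<^sub>0"
    using exit_vector(2)[OF \<rho>, of s] e by (auto simp: complex_nonpos_Reals_iff)
  from field_vector_diff_chain_at[OF f has_field_derivative_Ln[OF this]]
  have "((Ln \<circ> f) has_vector_derivative f' / f x) (at x)"
    by (simp add: divide_inverse mult.commute)
  then show ?thesis
    unfolding has_real_derivative_iff_has_vector_derivative
    using bounded_linear.has_vector_derivative[OF bounded_linear_Im] e by (simp add: o_def)
qed

lemma exit_vector_deriv_radius:
  fixes s :: real
  assumes \<rho>: "0 < \<rho>" "\<rho> < R"
  defines "T \<equiv> exit_time s \<rho>"
  shows "(exit_vector s has_vector_derivative cnj (c' s) * c' (s + T) * of_real (\<rho> / departure s T)) (at \<rho>)"
proof -
  have "(exit_time s has_derivative (*) (\<rho> / departure s T)) (at \<rho>)"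
    using exit_time_deriv_radius[OF \<rho>, of s] by (simp add: has_field_derivative_def T_def)
  then show ?thesis
    unfolding exit_vector_def chord_def has_vector_derivative_def
    by (auto intro!: derivative_eq_intros simp: T_def scaleR_conv_of_real fun_eq_iff algebra_simps)
qed

lemma exit_vector_deriv_base:
  fixes s :: real
  assumes \<rho>: "0 < \<rho>" "\<rho> < R"
  defines "T \<equiv> exit_time s \<rho>"
  assumes T': "((\<lambda>s. exit_time s \<rho>) has_real_derivative T') (at s)"
  shows "((\<lambda>s. exit_vector s \<rho>) has_vector_derivative
      cnj (c' s) * c' (s + T) * of_real (1 + T') - 1 - \<i> * curvature s * exit_vector s \<rho>) (at s)"
proof -
  have "((\<lambda>s. exit_time s \<rho>) has_derivative (*) T') (at s)"
    using T' by (simp add: has_field_derivative_def)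
  then have "((\<lambda>s. exit_vector s \<rho>) has_vector_derivative
      cnj (c'' s) * chord s T + cnj (c' s) * (of_real (1 + T') * c' (s + T) - c' s)) (at s)"
    unfolding exit_vector_def chord_def has_vector_derivative_def
    by (auto intro!: derivative_eq_intros simp: T_def scaleR_conv_of_real fun_eq_iff algebra_simps)
  also have "cnj (c'' s) * chord s T + cnj (c' s) * (of_real (1 + T') * c' (s + T) - c' s) =
      cnj (c' s) * c' (s + T) * of_real (1 + T') - 1 - \<i> * curvature s * exit_vector s \<rho>"
    using c'_unit(1)[of s] by (simp add: c''_eq[of s] exit_vector_def T_def algebra_simps)
  finally show ?thesis .
qed

lemma departure_eq: "departure s t = Re (cnj (chord s t) * c' (s + t))"
  by (simp add: departure_def inner_complex_def)

text \<open>Both partial derivatives of the exit point of the chord are multiples of the tangent there, and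
  the constraint \<open>\<bar>exit_vector s \<rho>\<bar> = \<rho>\<close> determines the multiples; eliminating that tangent
  leaves a relation between the partial derivatives of the angle and the curvature at \<open>s\<close>.\<close>

lemma exit_angle_partials:
  assumes \<rho>: "0 < \<rho>" "\<rho> < R"
  obtains a where "(exit_angle s has_real_derivative a) (at \<rho>)"
    and "((\<lambda>s. exit_angle s \<rho>) has_real_derivative
        (sin (exit_angle s \<rho>) / \<rho> + cos (exit_angle s \<rho>) * a - curvature s)) (at s)"
proof -
  define T where "T = exit_time s \<rho>"
  define w where "w = exit_vector s \<rho>"
  define z where "z = cnj (c' s) * c' (s + T) / w"
  define m where "m = departure s T"
  note T = exit_time[OF \<rho>, of s, folded T_def m_def]
  have w0: "w \<noteq> 0" and nw: "norm w = \<rho>" using exit_vector(1)[OF \<rho>, of s] \<rho> by (auto simp: w_def)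
  obtain T' where T': "((\<lambda>s. exit_time s \<rho>) has_real_derivative T') (at s)"
    using exit_time_deriv_base[OF \<rho>] by blast
  define a where "a = Im z * (\<rho> / m)"
  have "Im (cnj (c' s) * c' (s + T) * of_real (\<rho> / m) / w) = a"
  proof -
    have "cnj (c' s) * c' (s + T) * of_real (\<rho> / m) / w = z * of_real (\<rho> / m)" by (simp add: z_def)
    then show ?thesis by (simp add: a_def)
  qed
  then have deriv_a: "(exit_angle s has_real_derivative a) (at \<rho>)"
    using exit_angle_deriv[OF \<rho> refl exit_vector_deriv_radius[OF \<rho>], of s]
    by (simp add: exit_angle_def[abs_def] T_def m_def w_def)
  have Rez: "Re z = m / \<rho>\<^sup>2"
  proof -
    have "cnj w = c' s * cnj (chord s T)" by (simp add: w_def exit_vector_def T_def)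
    then have "cnj (c' s) * c' (s + T) * cnj w = (c' s * cnj (c' s)) * (cnj (chord s T) * c' (s + T))"
      by (simp only: mult_ac)
    then have "Re (cnj (c' s) * c' (s + T) * cnj w) = m"
      by (simp only: c'_unit mult_1 m_def departure_eq)
    moreover have "z = cnj (c' s) * c' (s + T) * cnj w / of_real (\<rho>\<^sup>2)"
      unfolding z_def using complex_div_cnj[of "cnj (c' s) * c' (s + T)" w] nw by simp
    ultimately show ?thesis by (simp only: Re_divide_of_real)
  qed
  have inv_w: "1 / w = cnj w / of_real (\<rho>\<^sup>2)"
    using complex_div_cnj[of 1 w] nw by simp
  have polar: "w = of_real \<rho> * cis (exit_angle s \<rho>)"
    unfolding w_def by (rule exit_vector_polar[OF \<rho>])
  then have Re_inv: "Re (1 / w) = cos (exit_angle s \<rho>) / \<rho>" and Im_inv: "Im (1 / w) = - sin (exit_angle s \<rho>) / \<rho>"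
    using \<rho> unfolding inv_w Re_divide_of_real Im_divide_of_real by (simp_all add: power2_eq_square)
  define w' where "w' = cnj (c' s) * c' (s + T) * of_real (1 + T') - 1 - \<i> * curvature s * w"
  have w': "((\<lambda>s. exit_vector s \<rho>) has_vector_derivative w') (at s)"
    using exit_vector_deriv_base[OF \<rho> T'] by (simp add: w'_def w_def T_def)
  have quot: "w' / w = z * of_real (1 + T') - 1 / w - \<i> * curvature s"
    using w0 by (simp add: w'_def z_def diff_divide_distrib)
  have "Re (w' / w) = 0"
  proof -
    have "((\<lambda>s. exit_vector s \<rho> \<bullet> exit_vector s \<rho>) has_real_derivative 2 * (w \<bullet> w')) (at s)"
      using w' unfolding has_vector_derivative_def has_field_derivative_def
      by (auto intro!: derivative_eq_intros simp: inner_commute fun_eq_iff w_def)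
    moreover have "(\<lambda>s. exit_vector s \<rho> \<bullet> exit_vector s \<rho>) = (\<lambda>s. \<rho>\<^sup>2)"
      using exit_vector(1)[OF \<rho>] by (simp add: fun_eq_iff power2_norm_eq_inner[symmetric])
    ultimately have "w \<bullet> w' = 0"
      using DERIV_unique[OF _ DERIV_const] by fastforce
    then have "Re (w' * cnj w) = 0" by (simp add: inner_complex_def mult.commute)
    then show ?thesis
      using complex_div_cnj[of w' w] nw by (simp flip: of_real_power)
  qed
  then have "Re z * (1 + T') = cos (exit_angle s \<rho>) / \<rho>"
    unfolding quot by (simp add: Re_inv del: Re_divide)
  then have "m / \<rho>\<^sup>2 * (1 + T') = cos (exit_angle s \<rho>) / \<rho>"
    by (simp only: Rez)
  moreover have "1 + T' = m / \<rho>\<^sup>2 * (1 + T') * (\<rho>\<^sup>2 / m)"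
    using T(4) \<rho> by simp
  ultimately have "1 + T' = cos (exit_angle s \<rho>) / \<rho> * (\<rho>\<^sup>2 / m)"
    by simp
  then have T'_eq: "1 + T' = cos (exit_angle s \<rho>) * (\<rho> / m)"
    using \<rho> by (simp add: power2_eq_square)
  have "Im (w' / w) = Im z * (1 + T') - Im (1 / w) - curvature s"
    unfolding quot by (simp del: Im_divide)
  also have "\<dots> = sin (exit_angle s \<rho>) / \<rho> + cos (exit_angle s \<rho>) * a - curvature s"
    unfolding Im_inv T'_eq a_def by simp
  finally have "((\<lambda>s. exit_angle s \<rho>) has_real_derivative
      (sin (exit_angle s \<rho>) / \<rho> + cos (exit_angle s \<rho>) * a - curvature s)) (at s)"
    using exit_angle_deriv[OF \<rho> refl w'] by (simp add: exit_angle_def[abs_def] w_def)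
  with deriv_a show thesis by (rule that)
qed

text \<open>Inside the disk of radius \<open>\<rho>\<close> around \<open>c s\<close> and ahead of \<open>c s\<close>, this is the signed area between
  the tangent and the curve, negative if the curve bends to the left. Here \<open>W\<close> is an antiderivative of
  \<open>Im (cnj c * c')\<close>; the first three terms are twice the area swept by the segment from \<open>c s\<close> to the
  moving point, and the last one is twice the circular sector between the tangent and the chord.\<close>

definition cap_area :: "(real \<Rightarrow> real) \<Rightarrow> real \<Rightarrow> real \<Rightarrow> real" where
  "cap_area W s \<rho> = (W (s + exit_time s \<rho>) - W s - Im (cnj (c s) * chord s (exit_time s \<rho>))
     - \<rho>\<^sup>2 * exit_angle s \<rho>) / 2"

text \<open>The area swept when the exit point moves and the change of the sector due to the angle cancel.\<close>

lemma cap_area_deriv_radius: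
  assumes W: "\<And>x. (W has_real_derivative Im (cnj (c x) * c' x)) (at x)" and \<rho>: "0 < \<rho>" "\<rho> < R"
  shows "(cap_area W s has_real_derivative - \<rho> * exit_angle s \<rho>) (at \<rho>)"
proof -
  define T where "T = exit_time s \<rho>"
  define q where "q = \<rho> / departure s T"
  define w where "w = exit_vector s \<rho>"
  have w0: "w \<noteq> 0" and nw: "norm w = \<rho>" using exit_vector(1)[OF \<rho>, of s] \<rho> by (auto simp: w_def)
  have T: "(exit_time s has_real_derivative q) (at \<rho>)"
    using exit_time_deriv_radius[OF \<rho>, of s] by (simp add: q_def T_def)
  define a where "a = Im (cnj (c' s) * c' (s + T) * of_real q / w)"
  have a: "(exit_angle s has_real_derivative a) (at \<rho>)"
    using exit_angle_deriv[OF \<rho> refl exit_vector_deriv_radius[OF \<rho>], of s]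
    by (simp add: exit_angle_def[abs_def] T_def q_def a_def w_def)
  have sector: "\<rho>\<^sup>2 * a = q * Im (cnj (chord s T) * c' (s + T))"
  proof -
    have "cnj w = c' s * cnj (chord s T)" by (simp add: w_def exit_vector_def T_def)
    then have "cnj (c' s) * c' (s + T) * of_real q * cnj w = (c' s * cnj (c' s)) * (cnj (chord s T) * c' (s + T)) * of_real q"
      by (simp only: mult_ac)
    then have "Im (cnj (c' s) * c' (s + T) * of_real q * cnj w) = q * Im (cnj (chord s T) * c' (s + T))"
      by (simp only: c'_unit mult_1) simp
    moreover have "cnj (c' s) * c' (s + T) * of_real q / w = cnj (c' s) * c' (s + T) * of_real q * cnj w / of_real (\<rho>\<^sup>2)"
      using complex_div_cnj[of "cnj (c' s) * c' (s + T) * of_real q" w] nw by simp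
    ultimately show ?thesis
      unfolding a_def using \<rho> by (simp only: Im_divide_of_real) simp
  qed
  have W1: "((\<lambda>\<rho>. W (s + exit_time s \<rho>)) has_real_derivative Im (cnj (c (s + T)) * c' (s + T)) * q) (at \<rho>)"
  proof -
    have "((\<lambda>\<rho>. s + exit_time s \<rho>) has_real_derivative q) (at \<rho>)"
      using T by (auto intro!: derivative_eq_intros)
    from DERIV_chain2[OF W this] show ?thesis by (simp only: T_def)
  qed
  have I1: "((\<lambda>\<rho>. Im (cnj (c s) * chord s (exit_time s \<rho>))) has_real_derivative q * Im (cnj (c s) * c' (s + T))) (at \<rho>)"
    using T unfolding chord_def has_field_derivative_def
    by (auto intro!: derivative_eq_intros simp: T_def fun_eq_iff algebra_simps)
  have "(cap_area W s has_real_derivative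
      (Im (cnj (c (s + T)) * c' (s + T)) * q - q * Im (cnj (c s) * c' (s + T))
       - (2 * \<rho> * exit_angle s \<rho> + \<rho>\<^sup>2 * a)) / 2) (at \<rho>)"
  proof -
    have "((\<lambda>\<rho>. \<rho>\<^sup>2 * exit_angle s \<rho>) has_real_derivative 2 * \<rho> * exit_angle s \<rho> + \<rho>\<^sup>2 * a) (at \<rho>)"
      using a by (auto intro!: derivative_eq_intros)
    from DERIV_diff[OF DERIV_diff[OF DERIV_diff[OF W1 DERIV_const] I1] this]
    show ?thesis unfolding cap_area_def[abs_def] diff_zero by (rule DERIV_cdivide)
  qed
  also have "(Im (cnj (c (s + T)) * c' (s + T)) * q - q * Im (cnj (c s) * c' (s + T))
       - (2 * \<rho> * exit_angle s \<rho> + \<rho>\<^sup>2 * a)) / 2 = - \<rho> * exit_angle s \<rho>"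
    unfolding sector chord_def by (simp add: algebra_simps)
  finally show ?thesis .
qed

text \<open>The curvature term is the rotation of the moving frame; it drops out of the difference of a cap
  and the cap of the reversed curve.\<close>

lemma cap_area_deriv_base:
  assumes W: "\<And>x. (W has_real_derivative Im (cnj (c x) * c' x)) (at x)" and \<rho>: "0 < \<rho>" "\<rho> < R"
  shows "((\<lambda>s. cap_area W s \<rho>) has_real_derivative
      \<rho>\<^sup>2 * curvature s / 2 - \<rho> * sin (exit_angle s \<rho>)) (at s)"
proof -
  define T where "T = exit_time s \<rho>"
  define w where "w = exit_vector s \<rho>"
  have w0: "w \<noteq> 0" and nw: "norm w = \<rho>" using exit_vector(1)[OF \<rho>, of s] \<rho> by (auto simp: w_def)
  obtain T' where T': "((\<lambda>s. exit_time s \<rho>) has_real_derivative T') (at s)"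
    using exit_time_deriv_base[OF \<rho>] by blast
  define w' where "w' = cnj (c' s) * c' (s + T) * of_real (1 + T') - 1 - \<i> * curvature s * w"
  have w': "((\<lambda>s. exit_vector s \<rho>) has_vector_derivative w') (at s)"
    using exit_vector_deriv_base[OF \<rho> T'] by (simp add: w'_def w_def T_def)
  define a where "a = Im (w' / w)"
  have a: "((\<lambda>s. exit_angle s \<rho>) has_real_derivative a) (at s)"
    using exit_angle_deriv[OF \<rho> refl w'] by (simp add: exit_angle_def[abs_def] w_def a_def)
  have Im_w: "Im w = \<rho> * sin (exit_angle s \<rho>)"
    unfolding w_def by (subst exit_vector_polar[OF \<rho>]) simp
  have sector: "\<rho>\<^sup>2 * a = (1 + T') * Im (cnj (chord s T) * c' (s + T)) + Im w - \<rho>\<^sup>2 * curvature s"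
  proof -
    have cw: "cnj w = c' s * cnj (chord s T)" by (simp add: w_def exit_vector_def T_def)
    have ww: "w * cnj w = of_real (\<rho>\<^sup>2)" using complex_norm_square[of w] nw by simp
    have "w' * cnj w = cnj (c' s) * c' (s + T) * of_real (1 + T') * cnj w - cnj w - \<i> * curvature s * (w * cnj w)"
      unfolding w'_def by (simp add: algebra_simps)
    also have "cnj (c' s) * c' (s + T) * of_real (1 + T') * cnj w
        = (c' s * cnj (c' s)) * (cnj (chord s T) * c' (s + T)) * of_real (1 + T')"
      unfolding cw by (simp only: mult_ac)
    finally have "w' * cnj w = cnj (chord s T) * c' (s + T) * of_real (1 + T') - cnj w - \<i> * curvature s * of_real (\<rho>\<^sup>2)"
      unfolding ww c'_unit mult_1 .
    moreover have "Im (A * of_real (1 + T') - cnj w - \<i> * curvature s * of_real (\<rho>\<^sup>2)) =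
        (1 + T') * Im A + Im w - \<rho>\<^sup>2 * curvature s" for A
      by (simp add: algebra_simps del: of_real_power)
    ultimately have "Im (w' * cnj w) = (1 + T') * Im (cnj (chord s T) * c' (s + T)) + Im w - \<rho>\<^sup>2 * curvature s"
      by (simp only:)
    moreover have "w' / w = w' * cnj w / of_real (\<rho>\<^sup>2)"
      using complex_div_cnj[of w' w] nw by simp
    ultimately show ?thesis
      unfolding a_def using \<rho> by (simp only: Im_divide_of_real) simp
  qed
  have W1: "((\<lambda>s. W (s + exit_time s \<rho>)) has_real_derivative Im (cnj (c (s + T)) * c' (s + T)) * (1 + T')) (at s)"
  proof -
    have "((\<lambda>s. s + exit_time s \<rho>) has_real_derivative 1 + T') (at s)"
      using T' by (auto intro!: derivative_eq_intros)
    from DERIV_chain2[OF W this] show ?thesis by (simp only: T_def)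
  qed
  have I1: "((\<lambda>s. Im (cnj (c s) * chord s (exit_time s \<rho>))) has_real_derivative
      Im (cnj (c' s) * chord s T) + ((1 + T') * Im (cnj (c s) * c' (s + T)) - Im (cnj (c s) * c' s))) (at s)"
    using T' unfolding chord_def has_field_derivative_def
    by (auto intro!: derivative_eq_intros simp: T_def fun_eq_iff algebra_simps)
  have "((\<lambda>s. cap_area W s \<rho>) has_real_derivative
      (Im (cnj (c (s + T)) * c' (s + T)) * (1 + T') - Im (cnj (c s) * c' s)
       - (Im (cnj (c' s) * chord s T) + ((1 + T') * Im (cnj (c s) * c' (s + T)) - Im (cnj (c s) * c' s)))
       - \<rho>\<^sup>2 * a) / 2) (at s)"
    unfolding cap_area_def[abs_def]
    by (rule DERIV_cdivide[OF DERIV_diff[OF DERIV_diff[OF DERIV_diff[OF W1 W] I1] DERIV_cmult[OF a]]])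
  also have "(Im (cnj (c (s + T)) * c' (s + T)) * (1 + T') - Im (cnj (c s) * c' s)
       - (Im (cnj (c' s) * chord s T) + ((1 + T') * Im (cnj (c s) * c' (s + T)) - Im (cnj (c s) * c' s)))
       - \<rho>\<^sup>2 * a) / 2 = \<rho>\<^sup>2 * curvature s / 2 - \<rho> * sin (exit_angle s \<rho>)"
  proof -
    have "cnj (c' s) * chord s T = w" by (simp add: w_def exit_vector_def T_def)
    moreover have "cnj (c (s + T)) = cnj (c s) + cnj (chord s T)" by (simp add: chord_def)
    ultimately show ?thesis
      unfolding sector Im_w[symmetric] by (simp add: ring_distribs)
  qed
  finally show ?thesis .
qed

text \<open>Near the starting point the distance grows with the parameter, so small circles are left early.\<close>

lemma exit_time_tendsto_0:
  assumes "0 < R"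
  shows "(exit_time s \<longlongrightarrow> 0) (at_right 0)"
proof (rule tendstoI)
  fix e :: real assume e: "0 < e"
  have "departure s 0 = 0" by (simp add: departure_def)
  have "(departure s has_real_derivative c' (s + 0) \<bullet> c' (s + 0) + chord s 0 \<bullet> c'' (s + 0)) (at 0)"
    unfolding departure_def chord_def has_field_derivative_def
    by (auto intro!: derivative_eq_intros simp: fun_eq_iff algebra_simps inner_commute)
  then have "(departure s has_real_derivative 1) (at 0)"
    using speed[of s] by (simp add: norm_eq_1)
  from DERIV_pos_inc_right[OF this]
  obtain d where d: "d > 0" "\<And>h. 0 < h \<Longrightarrow> h < d \<Longrightarrow> 0 < departure s h"
    using \<open>departure s 0 = 0\<close> by auto
  define h where "h = min (min d e) L / 2"
  have h: "0 < h" "h < d" "h < e" "h < L" using d(1) e L_pos by (auto simp: h_def min_def)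
  have "0 < min R (norm (chord s h))"
    using assms chord_nonzero[of h s] h by auto
  from eventually_at_right_real[OF this]
  have "\<forall>\<^sub>F \<rho> in at_right 0. \<rho> < min R (norm (chord s h))"
    by (rule eventually_mono) auto
  moreover have "\<forall>\<^sub>F \<rho> in at_right (0::real). 0 < \<rho>"
    by (simp add: eventually_at_right_less)
  ultimately show "\<forall>\<^sub>F \<rho> in at_right 0. dist (exit_time s \<rho>) 0 < e"
  proof eventually_elim
    case (elim \<rho>)
    have "continuous_on {0..h} (\<lambda>t. norm (chord s t))"
      using continuous_on_chord_right by (intro continuous_intros)
    then obtain t where t: "0 \<le> t" "t \<le> h" "norm (chord s t) = \<rho>"
      using IVT'[of "\<lambda>t. norm (chord s t)" 0 \<rho> h] elim h by auto
    then have "0 < t" using elim by (cases "t = 0") auto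
    then have "exit_time s \<rho> = t"
      using t d h elim by (intro exit_time_eqI) auto
    then show ?case using t h \<open>0 < t\<close> by (simp add: dist_real_def)
  qed
qed

lemma cap_area_tendsto_0:
  assumes W: "\<And>x. (W has_real_derivative Im (cnj (c x) * c' x)) (at x)" and R: "0 < R"
  shows "(cap_area W s \<longlongrightarrow> 0) (at_right 0)"
proof -
  have "isCont W s" using W[of s] by (rule DERIV_isCont)
  moreover have "((\<lambda>\<rho>. s + exit_time s \<rho>) \<longlongrightarrow> s) (at_right 0)"
    using tendsto_add[OF tendsto_const exit_time_tendsto_0[OF R], of s s] by simp
  ultimately have W1: "((\<lambda>\<rho>. W (s + exit_time s \<rho>)) \<longlongrightarrow> W s) (at_right 0)"
    by (rule isCont_tendsto_compose)
  have "isCont (chord s) 0"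
    using continuous_on_chord_right[of UNIV s] by (simp add: continuous_on_eq_continuous_at)
  from isCont_tendsto_compose[OF this exit_time_tendsto_0[OF R]]
  have E: "((\<lambda>\<rho>. chord s (exit_time s \<rho>)) \<longlongrightarrow> 0) (at_right 0)" by simp
  have "((\<lambda>\<rho>. \<rho>\<^sup>2 * exit_angle s \<rho>) \<longlongrightarrow> 0) (at_right 0)"
  proof (rule Lim_null_comparison)
    have "\<forall>\<^sub>F \<rho> in at_right 0. \<rho> < R"
      using R by (auto simp: eventually_at_right_field)
    moreover have "\<forall>\<^sub>F \<rho> in at_right (0::real). 0 < \<rho>"
      by (simp add: eventually_at_right_less)
    ultimately show "\<forall>\<^sub>F \<rho> in at_right 0. norm (\<rho>\<^sup>2 * exit_angle s \<rho>) \<le> \<rho>\<^sup>2 * (pi / 2)"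
    proof eventually_elim
      case (elim \<rho>)
      then show ?case
        using exit_angle_bounds[of \<rho> s] by (auto simp: abs_mult intro!: mult_left_mono)
    qed
    show "((\<lambda>\<rho>. \<rho>\<^sup>2 * (pi / 2)) \<longlongrightarrow> 0) (at_right (0::real))"
      by (auto intro!: tendsto_eq_intros)
  qed
  then have "((\<lambda>\<rho>. (W (s + exit_time s \<rho>) - W s - Im (cnj (c s) * chord s (exit_time s \<rho>))
      - \<rho>\<^sup>2 * exit_angle s \<rho>) / 2) \<longlongrightarrow> (W s - W s - Im (cnj (c s) * 0) - 0) / 2) (at_right 0)"
    by (intro tendsto_intros W1 E) auto
  then show ?thesis
    unfolding cap_area_def[abs_def] by simp
qed

end

section \<open>The area invariant in terms of the entry and exit angles\<close>

lemma (in transverse_curve) c'_period: "c' (s + L) = c' s"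
proof -
  have "((\<lambda>x. c (x + L)) has_vector_derivative c' (s + L)) (at s)"
    unfolding has_vector_derivative_def by (auto intro!: derivative_eq_intros)
  then have "(c has_vector_derivative c' (s + L)) (at s)"
    by (simp add: period)
  then show ?thesis
    using c_deriv[of s] by (rule vector_derivative_unique_at)
qed

lemma (in transverse_curve) periods: "c (s + of_int n * L) = c s" "c' (s + of_int n * L) = c' s"
  by (rule periodic_int, simp add: period c'_period)+

lemma (in transverse_curve) trace_from:
  assumes "z \<in> range c"
  obtains t where "0 \<le> t" "t < L" "z = c (s + t)"
proof -
  obtain x where x: "z = c x" using assms by auto
  obtain n :: int where n: "0 \<le> x - s + of_int n * L" "x - s + of_int n * L < L"
    by (rule shift_into_period[OF L_pos])
  have "c (s + (x - s + of_int n * L)) = z"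
    using periods(1)[of x n] by (simp add: x)
  with n show thesis by (intro that) auto
qed

lemma (in transverse_curve) trace_eq: "c ` {0..L} = range c"
proof
  show "range c \<subseteq> c ` {0..L}"
  proof
    fix z assume "z \<in> range c"
    then obtain t where "0 \<le> t" "t < L" "z = c (0 + t)" by (rule trace_from)
    then show "z \<in> c ` {0..L}" by auto
  qed
qed auto

text \<open>Running backwards turns the last entry into a disk into the first exit, so everything known
  about exits also holds for entries.\<close>

lemma (in transverse_curve) transverse_curve_reverse:
  "transverse_curve (\<lambda>s. c (- s)) (\<lambda>s. - c' (- s)) (\<lambda>s. c'' (- s)) L R"
proof
  fix s t :: real
  show "((\<lambda>s. c (- s)) has_vector_derivative - c' (- s)) (at s)"
    and "((\<lambda>s. - c' (- s)) has_vector_derivative c'' (- s)) (at s)"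
    unfolding has_vector_derivative_def by (auto intro!: derivative_eq_intros)
  show "c (- (s + L)) = c (- s)" using period[of "- s - L"] by simp
  show "c (- (s + t)) \<noteq> c (- s)" if "0 < t" "t < L"
    using simple[OF that, of "- s - t"] by auto
  show "- c' (- s) \<bullet> (c (- t) - c (- s)) \<noteq> 0" if "c (- t) \<noteq> c (- s)" "norm (c (- t) - c (- s)) < R"
    using transverse[OF that] by simp
qed (use L_pos speed in auto)

context transverse_curve begin

lemma Jordan:
  shows "open (inside (range c))" "open (outside (range c))"
    "inside (range c) \<inter> outside (range c) = {}"
    "inside (range c) \<union> outside (range c) = - range c"
    "frontier (outside (range c)) = range c" "closure (inside (range c)) = inside (range c) \<union> range c"
    "bounded (inside (range c))"
proof -
  define p where "p = (\<lambda>x. c (L * x))"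
  have "(*) L ` {0..1} = {0..L}" using L_pos image_mult_atLeastAtMost[of L 0 1] by simp
  then have "path_image p = c ` {0..L}"
    unfolding path_image_def p_def by (metis (no_types, lifting) image_cong image_image)
  then have img: "path_image p = range c" using trace_eq by simp
  have path: "path p"
    unfolding path_def p_def by (intro continuous_intros) auto
  have "loop_free p"
    unfolding loop_free_def
  proof (intro ballI impI)
    fix x y :: real assume xy: "x \<in> {0..1}" "y \<in> {0..1}" "p x = p y"
    have *: "a = 0 \<and> b = 1" if ab: "a \<in> {0..1}" "b \<in> {0..1}" "p a = p b" "a < b" for a b :: real
    proof (rule ccontr)
      assume "\<not> (a = 0 \<and> b = 1)"
      then have "b - a < 1" using ab by auto
      then have "L * (b - a) < L" using L_pos by simp
      then show False
        using simple[of "L * (b - a)" "L * a"] ab L_pos by (simp add: p_def algebra_simps)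
    qed
    show "x = y \<or> x = 0 \<and> y = 1 \<or> x = 1 \<and> y = 0"
      using *[of x y] *[of y x] xy by (cases x y rule: linorder_cases) auto
  qed
  then have "simple_path p" using path by (simp add: simple_path_def)
  moreover have "pathfinish p = pathstart p"
    using period[of 0] by (simp add: pathfinish_def pathstart_def p_def)
  ultimately have J: "open (inside (range c))" "open (outside (range c))"
    "inside (range c) \<inter> outside (range c) = {}"
    "inside (range c) \<union> outside (range c) = - range c"
    "frontier (outside (range c)) = range c" "frontier (inside (range c)) = range c" "bounded (inside (range c))"
    using Jordan_inside_outside[of p] unfolding img by auto
  then show "open (inside (range c))" "open (outside (range c))"
    "inside (range c) \<inter> outside (range c) = {}"
    "inside (range c) \<union> outside (range c) = - range c"
    "frontier (outside (range c)) = range c" "bounded (inside (range c))" by auto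
  show "closure (inside (range c)) = inside (range c) \<union> range c"
    using J(6) by (metis closure_Un_frontier)
qed

lemma connected_inside:
  assumes "connected A" "A \<inter> range c = {}" "A \<inter> inside (range c) \<noteq> {}"
  shows "A \<subseteq> inside (range c)"
  using connectedD[OF assms(1) Jordan(1,2)] Jordan(3,4) assms(2,3) by blast

lemma connected_outside:
  assumes "connected A" "A \<inter> range c = {}" "A \<inter> outside (range c) \<noteq> {}"
  shows "A \<subseteq> outside (range c)"
  using connectedD[OF assms(1) Jordan(1,2)] Jordan(3,4) assms(2,3) by blast

end

text \<open>Adds the counterclockwise orientation: the left normal points into the inner domain.\<close>

locale bounding_curve = transverse_curve +
  assumes R_pos: "0 < R"
    and inward: "\<And>s. \<forall>\<^sub>F \<epsilon> in at_right (0::real). c s + of_real \<epsilon> * \<i> * c' s \<in> inside (c ` {0..L})"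
begin

sublocale rev: transverse_curve "\<lambda>s. c (- s)" "\<lambda>s. - c' (- s)" "\<lambda>s. c'' (- s)" L R
  by (rule transverse_curve_reverse)

text \<open>In the moving frame the curve enters the disk of radius \<open>\<rho>\<close> around \<open>c s\<close> at the polar angle
  \<open>pi + entry_tilt s \<rho>\<close> and leaves it at the polar angle \<open>exit_angle s \<rho>\<close>.\<close>

definition entry_tilt :: "real \<Rightarrow> real \<Rightarrow> real" where
  "entry_tilt s \<rho> = rev.exit_angle (- s) \<rho>"

definition polar :: "real \<Rightarrow> real \<Rightarrow> real \<Rightarrow> complex" where
  "polar s \<rho> \<theta> = c s + of_real \<rho> * cis \<theta> * c' s"

lemma entry_tilt_bounds: "0 < \<rho> \<Longrightarrow> \<rho> < R \<Longrightarrow> \<bar>entry_tilt s \<rho>\<bar> < pi / 2"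
  unfolding entry_tilt_def by (rule rev.exit_angle_bounds)

lemma polar_exit: "0 < \<rho> \<Longrightarrow> \<rho> < R \<Longrightarrow> polar s \<rho> (exit_angle s \<rho>) \<in> range c"
proof -
  assume \<rho>: "0 < \<rho>" "\<rho> < R"
  have "of_real \<rho> * cis (exit_angle s \<rho>) * c' s = c' s * cnj (c' s) * chord s (exit_time s \<rho>)"
    unfolding exit_vector_polar[OF \<rho>, symmetric] exit_vector_def by (simp only: mult_ac)
  also have "\<dots> = chord s (exit_time s \<rho>)" by (simp only: c'_unit mult_1)
  finally show ?thesis by (simp add: polar_def chord_def)
qed

lemma polar_entry: "0 < \<rho> \<Longrightarrow> \<rho> < R \<Longrightarrow> polar s \<rho> (pi + entry_tilt s \<rho>) \<in> range c"
proof -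
  assume \<rho>: "0 < \<rho>" "\<rho> < R"
  have "cis (pi + entry_tilt s \<rho>) = - cis (entry_tilt s \<rho>)" by (simp add: cis_mult[symmetric])
  then have "of_real \<rho> * cis (pi + entry_tilt s \<rho>) * c' s = - (rev.exit_vector (- s) \<rho> * c' s)"
    by (simp add: rev.exit_vector_polar[OF \<rho>] entry_tilt_def)
  also have "\<dots> = c' s * cnj (c' s) * rev.chord (- s) (rev.exit_time (- s) \<rho>)"
    by (simp add: rev.exit_vector_def)
  also have "\<dots> = rev.chord (- s) (rev.exit_time (- s) \<rho>)" by (simp only: c'_unit mult_1)
  finally show ?thesis by (simp add: polar_def rev.chord_def)
qed

lemma polar_on_curve:
  assumes \<rho>: "0 < \<rho>" "\<rho> < R" and on: "polar s \<rho> \<theta> \<in> range c"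
  shows "cis \<theta> = cis (exit_angle s \<rho>) \<or> cis \<theta> = cis (pi + entry_tilt s \<rho>)"
proof -
  obtain t where t: "0 \<le> t" "t < L" "polar s \<rho> \<theta> = c (s + t)"
    using trace_from[OF on] by blast
  then have ch: "chord s t = of_real \<rho> * cis \<theta> * c' s"
    unfolding chord_def polar_def by (metis add_diff_cancel_left')
  then have nrm: "norm (chord s t) = \<rho>" using \<rho> speed by (simp add: norm_mult)
  then have "t \<noteq> 0" using \<rho> by auto
  then have t0: "0 < t" using t by simp
  have "cnj (c' s) * chord s t = cnj (c' s) * c' s * (of_real \<rho> * cis \<theta>)"
    unfolding ch by (simp only: mult_ac)
  then have frame: "cnj (c' s) * chord s t = of_real \<rho> * cis \<theta>" by (simp only: c'_unit mult_1)
  consider "departure s t > 0" | "departure s t < 0"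
    using departure_nonzero[of t s] t0 t nrm \<rho> by fastforce
  then show ?thesis
  proof cases
    case 1
    then have "exit_time s \<rho> = t" using t0 t nrm \<rho> by (intro exit_time_eqI) auto
    then have "of_real \<rho> * cis \<theta> = of_real \<rho> * cis (exit_angle s \<rho>)"
      using exit_vector_polar[OF \<rho>, of s] by (simp add: exit_vector_def frame)
    then show ?thesis using \<rho> by simp
  next
    case 2
    have "c (s + t - L) = c (s + t)" "c' (s + t - L) = c' (s + t)"
      using period[of "s + t - L"] c'_period[of "s + t - L"] by simp_all
    then have "rev.chord (- s) (L - t) = chord s t" "rev.departure (- s) (L - t) = - departure s t"
      unfolding rev.departure_def departure_def rev.chord_def chord_def by (simp_all add: algebra_simps)
    then have rt: "rev.exit_time (- s) \<rho> = L - t" and rc: "rev.chord (- s) (L - t) = chord s t"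
      using t0 t nrm \<rho> 2 by (auto intro!: rev.exit_time_eqI)
    have "rev.exit_vector (- s) \<rho> = - (of_real \<rho> * cis \<theta>)"
      unfolding rev.exit_vector_def rt rc by (simp add: frame[symmetric])
    then have "of_real \<rho> * cis \<theta> = of_real \<rho> * (- cis (entry_tilt s \<rho>))"
      using rev.exit_vector_polar[OF \<rho>, of "- s"] by (simp add: entry_tilt_def minus_equation_iff)
    then have "cis \<theta> = - cis (entry_tilt s \<rho>)" using \<rho> by (metis mult_cancel_left of_real_eq_0_iff order_less_irrefl)
    then show ?thesis by (simp add: cis_mult[symmetric])
  qed
qed

lemma polar_off_curve:
  assumes \<rho>: "0 < \<rho>" "\<rho> < R"
    and \<theta>: "exit_angle s \<rho> < \<theta>" "\<theta> < exit_angle s \<rho> + 2 * pi" "\<theta> \<noteq> pi + entry_tilt s \<rho>"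
  shows "polar s \<rho> \<theta> \<notin> range c"
proof
  assume "polar s \<rho> \<theta> \<in> range c"
  from polar_on_curve[OF \<rho> this] show False
  proof
    assume "cis \<theta> = cis (exit_angle s \<rho>)"
    then show False using cis_inj[of \<theta> "exit_angle s \<rho>"] \<theta> by auto
  next
    assume "cis \<theta> = cis (pi + entry_tilt s \<rho>)"
    moreover have "\<bar>\<theta> - (pi + entry_tilt s \<rho>)\<bar> < 2 * pi"
      using \<theta> exit_angle_bounds[OF \<rho>, of s] entry_tilt_bounds[OF \<rho>, of s] by linarith
    ultimately show False using cis_inj \<theta>(3) by blast
  qed
qed

text \<open>The arc at distance \<open>\<rho>\<close> that faces the inner side of the tangent is joined to an inner point by
  the inner normal, which avoids the curve within distance \<open>R\<close>.\<close>

lemma polar_inside: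
  assumes \<rho>: "0 < \<rho>" "\<rho> < R" and \<theta>: "exit_angle s \<rho> < \<theta>" "\<theta> < pi + entry_tilt s \<rho>"
  shows "polar s \<rho> \<theta> \<in> inside (range c)"
proof -
  define A where "A = polar s \<rho> ` {exit_angle s \<rho><..<pi + entry_tilt s \<rho>}"
  define B where "B = (\<lambda>x. polar s x (pi / 2)) ` {0<..<R}"
  have contA: "continuous_on UNIV (polar s \<rho>)" and contB: "continuous_on UNIV (\<lambda>x. polar s x (pi / 2))"
    unfolding polar_def by (intro continuous_intros)+
  have mid: "exit_angle s x < pi / 2" "pi / 2 < pi + entry_tilt s x" if "0 < x" "x < R" for x
    using exit_angle_bounds[OF that, of s] entry_tilt_bounds[OF that, of s] by linarith+
  have "connected (A \<union> B)"
  proof (rule connected_Un)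
    show "connected A" "connected B"
      unfolding A_def B_def using contA contB
      by (auto intro!: connected_continuous_image intro: continuous_on_subset)
    have "polar s \<rho> (pi / 2) \<in> A \<inter> B"
      using mid[OF \<rho>] \<rho> by (auto simp: A_def B_def)
    then show "A \<inter> B \<noteq> {}" by blast
  qed
  moreover have "(A \<union> B) \<inter> range c = {}"
  proof -
    define \<Gamma> where "\<Gamma> = range c"
    have "polar s \<rho> x \<notin> \<Gamma>" if "exit_angle s \<rho> < x" "x < pi + entry_tilt s \<rho>" for x
      unfolding \<Gamma>_def using polar_off_curve[OF \<rho>, of s x] that exit_angle_bounds[OF \<rho>, of s] entry_tilt_bounds[OF \<rho>, of s] by auto
    moreover have "polar s x (pi / 2) \<notin> \<Gamma>" if "0 < x" "x < R" for x
      unfolding \<Gamma>_def using polar_off_curve[OF that, of s "pi / 2"] mid[OF that] exit_angle_bounds[OF that, of s] by auto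
    ultimately have "(A \<union> B) \<inter> \<Gamma> = {}" by (auto simp: A_def B_def)
    then show ?thesis unfolding \<Gamma>_def .
  qed
  moreover have "(A \<union> B) \<inter> inside (range c) \<noteq> {}"
  proof -
    have "\<forall>\<^sub>F \<epsilon> in at_right 0. polar s \<epsilon> (pi / 2) \<in> inside (range c) \<and> \<epsilon> \<in> {0<..<R}"
      using inward[of s] eventually_at_right_real[OF R_pos] by eventually_elim (simp add: polar_def trace_eq)
    then obtain \<epsilon> where "polar s \<epsilon> (pi / 2) \<in> inside (range c)" "\<epsilon> \<in> {0<..<R}"
      using eventually_happens'[OF trivial_limit_at_right_real] by blast
    then have "polar s \<epsilon> (pi / 2) \<in> (A \<union> B) \<inter> inside (range c)" unfolding B_def by blast
    then show ?thesis by blast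
  qed
  ultimately have "A \<union> B \<subseteq> inside (range c)" by (rule connected_inside)
  then show ?thesis using \<theta> by (auto simp: A_def)
qed

lemma polar_exists:
  assumes \<rho>: "0 < \<rho>" "\<rho> < R" and y: "dist y (c s) = \<rho>"
  obtains \<phi> where "exit_angle s \<rho> \<le> \<phi>" "\<phi> < exit_angle s \<rho> + 2 * pi" "y = polar s \<rho> \<phi>"
proof -
  define v where "v = (y - c s) * cnj (c' s)"
  have "norm v = \<rho>" using y by (simp add: v_def norm_mult speed dist_norm)
  then have v: "v = of_real \<rho> * cis (Arg v)"
    by (metis Arg_eq cis_conv_exp norm_zero \<rho>(1) less_irrefl)
  define \<phi> where "\<phi> = (if exit_angle s \<rho> \<le> Arg v then Arg v else Arg v + 2 * pi)"
  have cis: "cis \<phi> = cis (Arg v)" by (simp add: \<phi>_def cis_mult[symmetric])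
  have "v * c' s = (y - c s) * (c' s * cnj (c' s))" by (simp add: v_def)
  then have "y = c s + v * c' s" by (simp add: c'_unit)
  then have "y = polar s \<rho> \<phi>"
    unfolding polar_def cis using v by simp
  moreover have "exit_angle s \<rho> \<le> \<phi>" "\<phi> < exit_angle s \<rho> + 2 * pi"
    using Arg_bounded[of v] exit_angle_bounds[OF \<rho>, of s] by (auto simp: \<phi>_def)
  ultimately show thesis using that by blast
qed

text \<open>Points of the outer domain accumulate at \<open>c s\<close>; they cannot lie on the inner arcs.\<close>

lemma outward:
  obtains x \<theta> where "0 < x" "x < R" "pi + entry_tilt s x < \<theta>" "\<theta> < exit_angle s x + 2 * pi"
    "polar s x \<theta> \<in> outside (range c)"
proof -
  have "c s \<in> closure (outside (range c))"
    using Jordan(5) by (metis frontier_def DiffD1 rangeI)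
  then obtain y where y: "y \<in> outside (range c)" "dist y (c s) < R"
    using R_pos by (meson closure_approachable)
  define x where "x = norm (y - c s)"
  have "c s \<notin> outside (range c)" using Jordan(4) by blast
  then have "y \<noteq> c s" using y by auto
  then have x: "0 < x" "x < R" using y by (auto simp: x_def dist_norm)
  have dist_x: "dist y (c s) = x" by (simp add: x_def dist_norm)
  obtain \<phi> where \<phi>: "exit_angle s x \<le> \<phi>" "\<phi> < exit_angle s x + 2 * pi" and y_eq: "y = polar s x \<phi>"
    by (rule polar_exists[OF x, of y s]) (rule dist_x)
  have y_off: "y \<notin> range c" "y \<notin> inside (range c)" using y(1) Jordan(3,4) by blast+
  have "\<phi> \<noteq> exit_angle s x" using polar_exit[OF x, of s] y_off y_eq by auto
  then have "\<not> \<phi> < pi + entry_tilt s x"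
    using polar_inside[OF x, of s \<phi>] \<phi> y_off y_eq by auto
  moreover have "\<phi> \<noteq> pi + entry_tilt s x" using polar_entry[OF x, of s] y_off y_eq by auto
  ultimately have "pi + entry_tilt s x < \<phi>" by linarith
  moreover have "polar s x \<phi> \<in> outside (range c)" using y(1) y_eq by simp
  ultimately show thesis
    by (intro that[OF x _ \<phi>(2)])
qed

text \<open>All arcs facing the outer side meet the outer normal, hence they lie in one component of the
  complement, and one of them contains an outer point.\<close>

lemma polar_outside:
  assumes \<rho>: "0 < \<rho>" "\<rho> < R" and \<theta>: "pi + entry_tilt s \<rho> < \<theta>" "\<theta> < exit_angle s \<rho> + 2 * pi"
  shows "polar s \<rho> \<theta> \<in> outside (range c)"
proof -
  define A where "A x = polar s x ` {pi + entry_tilt s x<..<exit_angle s x + 2 * pi}" for x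
  define B where "B = (\<lambda>x. polar s x (3 * pi / 2)) ` {0<..<R}"
  have contA: "continuous_on UNIV (polar s x)" and contB: "continuous_on UNIV (\<lambda>x. polar s x (3 * pi / 2))" for x
    unfolding polar_def by (intro continuous_intros)+
  have mid: "pi + entry_tilt s x < 3 * pi / 2" "3 * pi / 2 < exit_angle s x + 2 * pi" "exit_angle s x < 3 * pi / 2"
    if "0 < x" "x < R" for x
    using exit_angle_bounds[OF that, of s] entry_tilt_bounds[OF that, of s] by linarith+
  have conn: "connected (A x \<union> B)" if x: "0 < x" "x < R" for x
  proof (rule connected_Un)
    show "connected (A x)" "connected B"
      unfolding A_def B_def using contA contB
      by (auto intro!: connected_continuous_image intro: continuous_on_subset)
    have "polar s x (3 * pi / 2) \<in> A x \<inter> B"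
      using mid[OF x] x by (auto simp: A_def B_def)
    then show "A x \<inter> B \<noteq> {}" by blast
  qed
  have off: "(A x \<union> B) \<inter> range c = {}" if x: "0 < x" "x < R" for x
  proof -
    define \<Gamma> where "\<Gamma> = range c"
    have "polar s x y \<notin> \<Gamma>" if "pi + entry_tilt s x < y" "y < exit_angle s x + 2 * pi" for y
      unfolding \<Gamma>_def using polar_off_curve[OF x, of s y] that exit_angle_bounds[OF x, of s] entry_tilt_bounds[OF x, of s] by auto
    moreover have "polar s y (3 * pi / 2) \<notin> \<Gamma>" if "0 < y" "y < R" for y
      unfolding \<Gamma>_def using polar_off_curve[OF that, of s "3 * pi / 2"] mid[OF that] by auto
    ultimately have "(A x \<union> B) \<inter> \<Gamma> = {}" by (auto simp: A_def B_def)
    then show ?thesis unfolding \<Gamma>_def .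
  qed
  obtain x \<phi> where x: "0 < x" "x < R" and \<phi>: "pi + entry_tilt s x < \<phi>" "\<phi> < exit_angle s x + 2 * pi"
    "polar s x \<phi> \<in> outside (range c)"
    by (rule outward)
  then have "polar s x \<phi> \<in> (A x \<union> B) \<inter> outside (range c)" by (auto simp: A_def)
  then have "A x \<union> B \<subseteq> outside (range c)"
    using connected_outside[OF conn[OF x] off[OF x]] by blast
  moreover have "polar s \<rho> (3 * pi / 2) \<in> B" using \<rho> by (auto simp: B_def)
  ultimately have "(A \<rho> \<union> B) \<inter> outside (range c) \<noteq> {}" by blast
  from connected_outside[OF conn[OF \<rho>] off[OF \<rho>] this] show ?thesis
    using \<theta> by (auto simp: A_def)
qed

lemma polar_in_region_imp:
  assumes \<rho>: "0 < \<rho>" "\<rho> < R" and z: "z \<in> range c \<union> inside (range c)" "dist z (c s) = \<rho>"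
  obtains \<theta> where "exit_angle s \<rho> \<le> \<theta>" "\<theta> \<le> pi + entry_tilt s \<rho>" "z = polar s \<rho> \<theta>"
proof -
  obtain \<theta> where \<theta>: "exit_angle s \<rho> \<le> \<theta>" "\<theta> < exit_angle s \<rho> + 2 * pi" "z = polar s \<rho> \<theta>"
    using polar_exists[OF \<rho> z(2)] by blast
  moreover have "z \<notin> outside (range c)" using z(1) Jordan(3,4) by blast
  ultimately have "\<theta> \<le> pi + entry_tilt s \<rho>"
    using polar_outside[OF \<rho>, of s \<theta>] by force
  with \<theta> show thesis using that by blast
qed

lemma region_lmeasurable: "range c \<union> inside (range c) \<in> lmeasurable"
proof -
  have "closed (range c \<union> inside (range c))"
    using Jordan(6) by (metis closed_closure sup_commute)
  moreover have "bounded (range c \<union> inside (range c))"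
    using Jordan(6,7) by (metis bounded_closure sup_commute)
  ultimately show ?thesis
    by (simp add: compact_eq_bounded_closed lmeasurable_compact)
qed

definition disk_area :: "real \<Rightarrow> real \<Rightarrow> real" where
  "disk_area s \<rho> = measure lebesgue ((range c \<union> inside (range c)) \<inter> cball (c s) \<rho>)"

lemma disk_area_bounds: "0 \<le> \<rho> \<Longrightarrow> 0 \<le> disk_area s \<rho> \<and> disk_area s \<rho> \<le> pi * \<rho>\<^sup>2"
proof -
  assume "0 \<le> \<rho>"
  have "disk_area s \<rho> \<le> measure lebesgue (cball (c s) \<rho>)"
    unfolding disk_area_def using region_lmeasurable
    by (intro measure_mono_fmeasurable fmeasurable_Int_fmeasurable sets.Int) (auto simp: fmeasurableD)
  then show ?thesis
    using \<open>0 \<le> \<rho>\<close> by (simp add: content_cball unit_ball_vol_2 disk_area_def)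
qed

lemma measure_placed_sector:
  fixes s :: real
  assumes "0 \<le> r1" "r1 \<le> r2" "a \<le> b" "b \<le> a + 2 * pi"
  defines "P \<equiv> (\<lambda>w. c s + c' s * w) ` sector r1 r2 a b"
  shows "P \<in> lmeasurable" "measure lebesgue P = (b - a) * (r2\<^sup>2 - r1\<^sup>2) / 2"
proof -
  have P: "P = (+) (c s) ` ((*) (c' s) ` sector r1 r2 a b)"
    unfolding P_def by (simp add: image_image)
  have "(*) (c' s) ` sector r1 r2 a b = (\<lambda>w. cnj (c' s) * w) -` sector r1 r2 a b"
  proof safe
    fix z assume "cnj (c' s) * z \<in> sector r1 r2 a b"
    moreover have "z = c' s * (cnj (c' s) * z)"
      by (simp only: mult.assoc[symmetric] c'_unit mult_1)
    ultimately show "z \<in> (*) (c' s) ` sector r1 r2 a b" by blast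
  qed (simp add: mult.assoc[symmetric] c'_unit)
  moreover have "continuous_on UNIV (\<lambda>w. cnj (c' s) * w)" by (intro continuous_intros)
  from measurable_sets_borel[OF borel_measurable_continuous_onI[OF this] sector_borel[of r1 r2 a b]]
  have "(\<lambda>w. cnj (c' s) * w) -` sector r1 r2 a b \<in> sets borel" by simp
  ultimately have "(*) (c' s) ` sector r1 r2 a b \<in> sets borel" by simp
  moreover have "bounded ((*) (c' s) ` sector r1 r2 a b)"
    using bounded_sector[OF assms(1)] bounded_linear_image[OF _ bounded_linear_mult_right] by blast
  ultimately have m: "(*) (c' s) ` sector r1 r2 a b \<in> lmeasurable"
    by (intro bounded_set_imp_lmeasurable) auto
  then show "P \<in> lmeasurable" unfolding P by (rule measurable_translation)
  show "measure lebesgue P = (b - a) * (r2\<^sup>2 - r1\<^sup>2) / 2"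
    unfolding P measure_translation
    using measure_rotation_complex[OF speed sector_borel bounded_sector[OF assms(1)]] measure_sector[OF assms(1-4)]
    by simp
qed

text \<open>Where the angles vary by less than \<open>d\<close>, the annular part of the region lies between two annular
  sectors.\<close>

lemma disk_area_increment:
  assumes r: "0 < r1" "r1 \<le> r2" "r2 < R"
    and a: "\<And>\<rho>. r1 \<le> \<rho> \<Longrightarrow> \<rho> \<le> r2 \<Longrightarrow> \<bar>exit_angle s \<rho> - a\<bar> < d"
    and b: "\<And>\<rho>. r1 \<le> \<rho> \<Longrightarrow> \<rho> \<le> r2 \<Longrightarrow> \<bar>pi + entry_tilt s \<rho> - b\<bar> < d"
    and d: "a + d \<le> b - d" "b + d \<le> a - d + 2 * pi" "0 < d"
  shows "\<bar>disk_area s r2 - disk_area s r1 - (b - a) * (r2\<^sup>2 - r1\<^sup>2) / 2\<bar> \<le> d * (r2\<^sup>2 - r1\<^sup>2)"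
proof -
  let ?G = "range c \<union> inside (range c)"
  define D where "D = ?G \<inter> cball (c s) r2 - ?G \<inter> cball (c s) r1"
  define lower where "lower = (\<lambda>w. c s + c' s * w) ` sector r1 r2 (a + d) (b - d)"
  define upper where "upper = (\<lambda>w. c s + c' s * w) ` sector r1 r2 (a - d) (b + d)"
  have lm: "?G \<inter> cball (c s) x \<in> lmeasurable" for x
    using region_lmeasurable by (intro fmeasurable.Int) auto
  then have D: "D \<in> lmeasurable" unfolding D_def by (intro fmeasurable_Diff) (auto simp: fmeasurableD)
  define X where "X = (b - a) * (r2\<^sup>2 - r1\<^sup>2) / 2"
  define Y where "Y = d * (r2\<^sup>2 - r1\<^sup>2)"
  have XY: "(b - d - (a + d)) * (r2\<^sup>2 - r1\<^sup>2) / 2 = X - Y" "(b + d - (a - d)) * (r2\<^sup>2 - r1\<^sup>2) / 2 = X + Y"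
    unfolding X_def Y_def by (simp_all add: field_simps)
  have "measure lebesgue D = disk_area s r2 - disk_area s r1"
    unfolding D_def disk_area_def using r lm by (intro measurable_measure_Diff) (auto simp: fmeasurableD)
  moreover have "lower \<subseteq> D"
  proof
    fix z assume "z \<in> lower"
    then obtain \<rho> \<theta> where \<rho>: "r1 < \<rho>" "\<rho> \<le> r2" and \<theta>: "a + d < \<theta>" "\<theta> \<le> b - d" and z: "z = polar s \<rho> \<theta>"
      unfolding lower_def sector_def polar_def by (auto simp: mult.commute mult.assoc)
    have "exit_angle s \<rho> < \<theta>" "\<theta> < pi + entry_tilt s \<rho>"
      using a[of \<rho>] b[of \<rho>] \<rho> \<theta> by linarith+
    then have "z \<in> inside (range c)"
      unfolding z using \<rho> r by (intro polar_inside) auto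
    moreover have "dist (c s) z = \<rho>"
      unfolding z polar_def using \<rho> r by (simp add: dist_norm norm_mult speed)
    ultimately show "z \<in> D" using \<rho> by (auto simp: D_def)
  qed
  then have "measure lebesgue lower \<le> measure lebesgue D"
    using D measure_placed_sector(1)[of r1 r2 "a + d" "b - d" s] r d
    by (intro measure_mono_fmeasurable) (auto simp: lower_def fmeasurableD)
  moreover have "D \<subseteq> upper"
  proof
    fix z assume z: "z \<in> D"
    define \<rho> where "\<rho> = dist z (c s)"
    have \<rho>: "r1 < \<rho>" "\<rho> \<le> r2" using z by (auto simp: D_def \<rho>_def dist_commute)
    obtain \<theta> where \<theta>: "exit_angle s \<rho> \<le> \<theta>" "\<theta> \<le> pi + entry_tilt s \<rho>" "z = polar s \<rho> \<theta>"
    proof (rule polar_in_region_imp)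
      show "0 < \<rho>" "\<rho> < R" using \<rho> r by linarith+
      show "z \<in> range c \<union> inside (range c)" using z by (simp add: D_def)
    qed (rule \<rho>_def[symmetric])
    have "a - d < \<theta>" "\<theta> \<le> b + d"
      using a[of \<rho>] b[of \<rho>] \<rho> \<theta> by linarith+
    then have "of_real \<rho> * cis \<theta> \<in> sector r1 r2 (a - d) (b + d)"
      using \<rho> unfolding sector_def by (intro image_eqI[of _ _ "(\<rho>, \<theta>)"]) auto
    then show "z \<in> upper"
      unfolding upper_def \<theta>(3) polar_def by (intro image_eqI[of _ _ "of_real \<rho> * cis \<theta>"]) (simp_all add: mult.commute)
  qed
  then have "measure lebesgue D \<le> measure lebesgue upper"
    using D measure_placed_sector(1)[of r1 r2 "a - d" "b + d" s] r d
    by (intro measure_mono_fmeasurable) (auto simp: upper_def fmeasurableD)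
  moreover have "measure lebesgue lower = X - Y"
    unfolding lower_def XY[symmetric] by (rule measure_placed_sector(2)) (use r d in auto)
  moreover have "measure lebesgue upper = X + Y"
    unfolding upper_def XY[symmetric] by (rule measure_placed_sector(2)) (use r d in auto)
  ultimately show ?thesis unfolding X_def[symmetric] Y_def[symmetric] by linarith
qed

lemma disk_area_deriv_radius:
  assumes \<rho>: "0 < \<rho>" "\<rho> < R"
  shows "(disk_area s has_real_derivative \<rho> * (pi + entry_tilt s \<rho> - exit_angle s \<rho>)) (at \<rho>)"
proof -
  define a where "a = exit_angle s \<rho>"
  define b where "b = pi + entry_tilt s \<rho>"
  have ab: "a < b" "b < a + 2 * pi"
    using exit_angle_bounds[OF \<rho>, of s] entry_tilt_bounds[OF \<rho>, of s] by (auto simp: a_def b_def)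
  (* Annuli have area proportional to the difference of the squared radii, so the squared radius is
     the natural variable; the factor x + \<rho> is restored at the end. *)
  define e where "e x = (disk_area s x - disk_area s \<rho>) / (x\<^sup>2 - \<rho>\<^sup>2)" for x
  have "(e \<longlongrightarrow> (b - a) / 2) (at \<rho>)"
  proof (rule tendstoI)
    fix \<epsilon> :: real assume "0 < \<epsilon>"
    (* The last two bounds keep the two sectors nonempty and less than a full turn. *)
    define d where "d = min (\<epsilon> / 2) (min ((b - a) / 2) ((a + 2 * pi - b) / 2))"
    have d: "0 < d" "d < \<epsilon>" "a + d \<le> b - d" "b + d \<le> a - d + 2 * pi"
    proof -
      have "d \<le> \<epsilon> / 2" "d \<le> (b - a) / 2" "d \<le> (a + 2 * pi - b) / 2" unfolding d_def by linarith+
      then show "d < \<epsilon>" "a + d \<le> b - d" "b + d \<le> a - d + 2 * pi" using \<open>0 < \<epsilon>\<close> by auto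
      show "0 < d" unfolding d_def using ab \<open>0 < \<epsilon>\<close> by simp
    qed
    have "isCont (exit_angle s) \<rho>"
      using exit_angle_partials[OF \<rho>, of s] DERIV_isCont by blast
    moreover have "isCont (entry_tilt s) \<rho>"
      unfolding entry_tilt_def using rev.exit_angle_partials[OF \<rho>, of "- s"] DERIV_isCont by blast
    ultimately have lim: "(exit_angle s \<longlongrightarrow> a) (nhds \<rho>)" "((\<lambda>x. pi + entry_tilt s x) \<longlongrightarrow> b) (nhds \<rho>)"
      unfolding a_def b_def by (auto intro!: tendsto_intros simp: continuous_at tendsto_nhds_iff)
    have near: "\<forall>\<^sub>F x in nhds \<rho>. x \<in> {0<..<R}"
      using \<rho> by (intro eventually_nhds_in_open) auto
    have "\<forall>\<^sub>F x in nhds \<rho>. \<bar>exit_angle s x - a\<bar> < d \<and> \<bar>pi + entry_tilt s x - b\<bar> < d \<and> x \<in> {0<..<R}"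
      using tendstoD[OF lim(1) d(1)] tendstoD[OF lim(2) d(1)] near
      unfolding dist_real_def by eventually_elim simp
    then obtain h where h: "h > 0" "\<And>x. dist x \<rho> < h \<Longrightarrow>
        \<bar>exit_angle s x - a\<bar> < d \<and> \<bar>pi + entry_tilt s x - b\<bar> < d \<and> x \<in> {0<..<R}"
      unfolding eventually_nhds_metric by blast
    have "dist (e x) ((b - a) / 2) < \<epsilon>" if x: "dist x \<rho> < h" "x \<noteq> \<rho>" for x
    proof -
      have "x > 0" using h(2)[OF x(1)] by auto
      have sq: "x\<^sup>2 - \<rho>\<^sup>2 \<noteq> 0" using x(2) \<open>x > 0\<close> \<rho> by (simp add: power2_eq_iff)
      have main: "\<bar>disk_area s v - disk_area s u - (b - a) * (v\<^sup>2 - u\<^sup>2) / 2\<bar> \<le> d * (v\<^sup>2 - u\<^sup>2)"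
        if uv: "u \<le> v" "dist u \<rho> < h" "dist v \<rho> < h" for u v
      proof -
        have "dist y \<rho> < h" if "u \<le> y" "y \<le> v" for y
          using that uv by (auto simp: dist_real_def)
        then show ?thesis
          using h(2) uv d by (intro disk_area_increment) auto
      qed
      have "\<bar>disk_area s x - disk_area s \<rho> - (b - a) / 2 * (x\<^sup>2 - \<rho>\<^sup>2)\<bar> \<le> d * \<bar>x\<^sup>2 - \<rho>\<^sup>2\<bar>"
      proof (cases "\<rho> \<le> x")
        case True
        then have "\<rho>\<^sup>2 \<le> x\<^sup>2" using \<rho> by (intro power_mono) auto
        then show ?thesis using main[of \<rho> x] x h(1) True by simp
      next
        case False
        then have "x\<^sup>2 \<le> \<rho>\<^sup>2" using \<open>x > 0\<close> by (intro power_mono) auto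
        then have "\<bar>x\<^sup>2 - \<rho>\<^sup>2\<bar> = \<rho>\<^sup>2 - x\<^sup>2" by simp
        moreover have "disk_area s x - disk_area s \<rho> - (b - a) / 2 * (x\<^sup>2 - \<rho>\<^sup>2)
            = - (disk_area s \<rho> - disk_area s x - (b - a) * (\<rho>\<^sup>2 - x\<^sup>2) / 2)"
          by (simp add: field_simps)
        ultimately show ?thesis using main[of x \<rho>] x h(1) False by (simp only: abs_minus_cancel) simp
      qed
      moreover have "e x - (b - a) / 2 = (disk_area s x - disk_area s \<rho> - (b - a) / 2 * (x\<^sup>2 - \<rho>\<^sup>2)) / (x\<^sup>2 - \<rho>\<^sup>2)"
        using sq by (simp add: e_def diff_divide_distrib)
      ultimately have "\<bar>e x - (b - a) / 2\<bar> \<le> d"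
        using sq by (simp add: abs_divide pos_divide_le_eq)
      then show ?thesis using d(2) by (simp add: dist_real_def)
    qed
    then show "\<forall>\<^sub>F x in at \<rho>. dist (e x) ((b - a) / 2) < \<epsilon>"
      unfolding eventually_at using h(1) by blast
  qed
  moreover have "((\<lambda>x. x + \<rho>) \<longlongrightarrow> 2 * \<rho>) (at \<rho>)" by (auto intro!: tendsto_eq_intros)
  ultimately have "((\<lambda>x. e x * (x + \<rho>)) \<longlongrightarrow> (b - a) / 2 * (2 * \<rho>)) (at \<rho>)"
    by (rule tendsto_mult)
  then have "((\<lambda>x. e x * (x + \<rho>)) \<longlongrightarrow> \<rho> * (b - a)) (at \<rho>)"
    by (simp add: mult.commute)
  moreover have "\<forall>\<^sub>F x in at \<rho>. e x * (x + \<rho>) = (disk_area s x - disk_area s \<rho>) / (x - \<rho>)"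
  proof -
    have "\<forall>\<^sub>F x in at \<rho>. x \<in> {0<..<R} \<and> x \<noteq> \<rho>"
      using \<rho> by (intro eventually_conj eventually_at_in_open' eventually_neq_at_within) auto
    then show ?thesis
    proof eventually_elim
      case (elim x)
      have "x\<^sup>2 - \<rho>\<^sup>2 = (x - \<rho>) * (x + \<rho>)" by (simp add: power2_eq_square algebra_simps)
      then show ?case using elim \<rho> by (simp add: e_def)
    qed
  qed
  ultimately show ?thesis
    unfolding has_field_derivative_iff a_def[symmetric] b_def[symmetric] by (rule Lim_transform_eventually)
qed

text \<open>The half disk on the inner side of the tangent, corrected by the caps ahead of and behind
  \<open>c s\<close>; the reversed curve bends to the other side, so its cap has the opposite sign. Both sides have
  the same radial derivative and vanish with the radius.\<close>

lemma disk_area_eq: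
  assumes W: "\<And>x. (W has_real_derivative Im (cnj (c x) * c' x)) (at x)" and \<rho>: "0 < \<rho>" "\<rho> < R"
  shows "disk_area s \<rho> = cap_area W s \<rho> - rev.cap_area (\<lambda>x. W (- x)) (- s) \<rho> + pi * \<rho>\<^sup>2 / 2"
proof -
  have W': "((\<lambda>x. W (- x)) has_real_derivative Im (cnj (c (- x)) * (- c' (- x)))) (at x)" for x
    using DERIV_chain2[OF W DERIV_minus[OF DERIV_ident]] by (simp add: algebra_simps)
  define F where "F x = disk_area s x - (cap_area W s x - rev.cap_area (\<lambda>x. W (- x)) (- s) x + pi * x\<^sup>2 / 2)" for x
  have "(F has_real_derivative 0) (at x)" if x: "0 < x" "x < R" for x
    unfolding F_def
    using disk_area_deriv_radius[OF x, of s] cap_area_deriv_radius[OF W x, of s] rev.cap_area_deriv_radius[OF W' x, of "- s"]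
    by (auto intro!: derivative_eq_intros simp: entry_tilt_def algebra_simps)
  then have "\<exists>k. \<forall>x\<in>{0<..<R}. F x = k"
    by (intro has_field_derivative_zero_constant) (auto intro: has_field_derivative_at_within)
  then obtain k where k: "\<And>x. x \<in> {0<..<R} \<Longrightarrow> F x = k" by blast
  have "(disk_area s \<longlongrightarrow> 0) (at_right 0)"
  proof (rule Lim_null_comparison)
    show "\<forall>\<^sub>F x in at_right 0. norm (disk_area s x) \<le> pi * x\<^sup>2"
      using eventually_at_right_less[of "0 :: real"] by eventually_elim (use disk_area_bounds in auto)
    show "((\<lambda>x. pi * x\<^sup>2) \<longlongrightarrow> 0) (at_right (0::real))" by (auto intro!: tendsto_eq_intros)
  qed
  then have "((\<lambda>x. disk_area s x - (cap_area W s x - rev.cap_area (\<lambda>x. W (- x)) (- s) x + pi * x\<^sup>2 / 2))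
      \<longlongrightarrow> 0 - (0 - 0 + pi * 0\<^sup>2 / 2)) (at_right 0)"
    by (intro tendsto_intros cap_area_tendsto_0[OF W R_pos] rev.cap_area_tendsto_0[OF W' R_pos]) auto
  then have "(F \<longlongrightarrow> 0) (at_right 0)" by (simp add: F_def[abs_def])
  moreover have "\<forall>\<^sub>F x in at_right 0. F x = k"
    using eventually_at_right_real[OF R_pos] by eventually_elim (rule k)
  ultimately have "((\<lambda>x. k) \<longlongrightarrow> 0) (at_right (0::real))"
    using tendsto_cong by force
  then have "k = 0" using tendsto_const_iff[OF trivial_limit_at_right_real] by blast
  then show ?thesis using k[of \<rho>] \<rho> by (simp add: F_def)
qed

lemma disk_area_deriv_base:
  assumes \<rho>: "0 < \<rho>" "\<rho> < R"
  shows "((\<lambda>s. disk_area s \<rho>) has_real_derivative - \<rho> * (sin (exit_angle s \<rho>) + sin (entry_tilt s \<rho>))) (at s)"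
proof -
  have "isCont (\<lambda>x. Im (cnj (c x) * c' x)) x" for x
    using continuous_on_c continuous_on_c' by (auto simp: continuous_on_eq_continuous_at intro!: continuous_intros)
  then obtain W where W: "\<And>x. (W has_real_derivative Im (cnj (c x) * c' x)) (at x)"
    using einterval_antiderivative[of "- \<infinity>" \<infinity> "\<lambda>x. Im (cnj (c x) * c' x)"]
    by (auto simp: has_real_derivative_iff_has_vector_derivative)
  have W': "((\<lambda>x. W (- x)) has_real_derivative Im (cnj (c (- x)) * (- c' (- x)))) (at x)" for x
    using DERIV_chain2[OF W DERIV_minus[OF DERIV_ident]] by (simp add: algebra_simps)
  have "((\<lambda>s. rev.cap_area (\<lambda>x. W (- x)) (- s) \<rho>) has_real_derivative
      (\<rho>\<^sup>2 * rev.curvature (- s) / 2 - \<rho> * sin (rev.exit_angle (- s) \<rho>)) * - 1) (at s)"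
    by (rule DERIV_chain2[OF rev.cap_area_deriv_base[OF W' \<rho>]]) (auto intro!: derivative_eq_intros)
  moreover have "rev.curvature (- s) = - curvature s"
    by (simp add: rev.curvature_def curvature_def)
  ultimately have "((\<lambda>s. cap_area W s \<rho> - rev.cap_area (\<lambda>x. W (- x)) (- s) \<rho> + pi * \<rho>\<^sup>2 / 2) has_real_derivative
      - \<rho> * (sin (exit_angle s \<rho>) + sin (entry_tilt s \<rho>))) (at s)"
    using cap_area_deriv_base[OF W \<rho>, of s]
    by (auto intro!: derivative_eq_intros simp: entry_tilt_def algebra_simps)
  then show ?thesis by (simp add: disk_area_eq[OF W \<rho>])
qed

lemma entry_tilt_partials:
  assumes \<rho>: "0 < \<rho>" "\<rho> < R"
  obtains b where "(entry_tilt s has_real_derivative b) (at \<rho>)"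
    and "((\<lambda>s. entry_tilt s \<rho>) has_real_derivative
        - (sin (entry_tilt s \<rho>) / \<rho> + cos (entry_tilt s \<rho>) * b + curvature s)) (at s)"
proof -
  obtain b where b: "(rev.exit_angle (- s) has_real_derivative b) (at \<rho>)"
    "((\<lambda>s. rev.exit_angle s \<rho>) has_real_derivative (sin (rev.exit_angle (- s) \<rho>) / \<rho>
        + cos (rev.exit_angle (- s) \<rho>) * b - rev.curvature (- s))) (at (- s))"
    by (rule rev.exit_angle_partials[OF \<rho>])
  have "rev.curvature (- s) = - curvature s"
    by (simp add: rev.curvature_def curvature_def)
  moreover have "((\<lambda>s. rev.exit_angle (- s) \<rho>) has_real_derivative (sin (rev.exit_angle (- s) \<rho>) / \<rho>
        + cos (rev.exit_angle (- s) \<rho>) * b - rev.curvature (- s)) * - 1) (at s)"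
    by (rule DERIV_chain2[where f = "\<lambda>s. rev.exit_angle s \<rho>" and g = uminus, OF b(2)])
      (auto intro!: derivative_eq_intros)
  ultimately show thesis
    using that[of b] b(1) by (simp add: entry_tilt_def[abs_def])
qed

end

section \<open>Tangentially graph-like curves\<close>

lemma (in transverse_curve) base_interval:
  obtains s' where "s' \<in> {0..L}" "c s' = c s" "c' s' = c' s"
proof -
  obtain n :: int where n: "0 \<le> s + of_int n * L" "s + of_int n * L < L"
    by (rule shift_into_period[OF L_pos])
  then show thesis
    using periods[of s n] by (intro that[of "s + of_int n * L"]) auto
qed

lemma (in transverse_curve) frontier_region: "frontier (region L c) = range c"
proof -
  have "region L c = - outside (range c)"
    unfolding region_def trace_eq using Jordan(3,4) by blast
  then show ?thesis using Jordan(5) by (simp add: frontier_complement)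
qed

text \<open>The graph has slope \<open>0\<close> at the origin, so its first axis is tangent to the curve; as a graph it
  has no second point on the second axis.\<close>

lemma (in transverse_curve) graph_like_imp_transverse:
  assumes r: "0 < r" and graph: "tangentially_graph_like_at (region L c) (c s) r"
    and q: "q \<in> range c" "q \<noteq> c s" "norm (q - c s) \<le> r"
  shows "c' s \<bullet> (q - c s) \<noteq> 0"
proof
  assume perp: "c' s \<bullet> (q - c s) = 0"
  obtain u A f where uAf: "norm u = 1 \<and> 0 \<in> interior A \<and>
      frontier (region L c) \<inter> cball (c s) r = (\<lambda>x. c s + u * Complex x (f x)) ` A \<and>
      f 0 = 0 \<and> (f has_real_derivative 0) (at 0) \<and>
      (\<forall>\<^sub>F \<epsilon> in at_right 0. c s + u * Complex 0 \<epsilon> \<in> region L c)"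
    using graph unfolding tangentially_graph_like_at_def by (elim exE) (erule that)
  note u = uAf[THEN conjunct1]
  have f: "range c \<inter> cball (c s) r = (\<lambda>x. c s + u * Complex x (f x)) ` A" "f 0 = 0"
      "(f has_real_derivative 0) (at 0)"
    using uAf unfolding frontier_region by simp_all
  have uu: "cnj u * u = 1" "u * cnj u = 1"
    using u complex_norm_square[of u] by (simp_all add: mult.commute)
  define v where "v t = cnj u * (c t - c s)" for t
  have vc: "v t = Complex (Re (v t)) (f (Re (v t)))" if near: "c t \<in> cball (c s) r" for t
  proof -
    have "c t \<in> range c \<inter> cball (c s) r" using near by simp
    then obtain x where x: "c t = c s + u * Complex x (f x)"
      unfolding f(1) by (rule imageE)
    have "v t = cnj u * u * Complex x (f x)" by (simp add: v_def x)
    then have "v t = Complex x (f x)" by (simp only: uu mult_1)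
    then show ?thesis by simp
  qed
  have v_deriv: "(v has_vector_derivative cnj u * c' s) (at s)"
    unfolding v_def[abs_def] has_vector_derivative_def by (auto intro!: derivative_eq_intros)
  have x_deriv: "((\<lambda>t. Re (v t)) has_real_derivative Re (cnj u * c' s)) (at s)"
    and y_deriv: "((\<lambda>t. Im (v t)) has_real_derivative Im (cnj u * c' s)) (at s)"
    unfolding has_real_derivative_iff_has_vector_derivative
    using bounded_linear.has_vector_derivative[OF bounded_linear_Re v_deriv]
      bounded_linear.has_vector_derivative[OF bounded_linear_Im v_deriv] by auto
  have "Re (v s) = 0" by (simp add: v_def)
  then have "((\<lambda>t. f (Re (v t))) has_real_derivative 0 * Re (cnj u * c' s)) (at s)"
    using f(3) by (intro DERIV_chain2[OF _ x_deriv]) simp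
  moreover have "\<forall>\<^sub>F t in nhds s. f (Re (v t)) = Im (v t)"
  proof -
    have "open (c -` ball (c s) r)"
      using continuous_on_c by (intro open_vimage) auto
    then have "\<forall>\<^sub>F t in nhds s. t \<in> c -` ball (c s) r"
      using r by (intro eventually_nhds_in_open) auto
    then show ?thesis
    proof eventually_elim
      case (elim t)
      then have "c t \<in> cball (c s) r" by auto
      then show ?case using vc[of t] by (metis complex.sel(2))
    qed
  qed
  ultimately have "((\<lambda>t. Im (v t)) has_real_derivative 0 * Re (cnj u * c' s)) (at s)"
    using DERIV_cong_ev[OF refl, of "\<lambda>t. f (Re (v t))" "\<lambda>t. Im (v t)" s] by blast
  then have "Im (cnj u * c' s) = 0"
    using DERIV_unique[OF y_deriv] by simp
  define k where "k = Re (cnj u * c' s)"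
  have k: "cnj u * c' s = of_real k"
    using \<open>Im (cnj u * c' s) = 0\<close> by (simp add: k_def complex_eq_iff)
  have "\<bar>k\<bar> = 1"
    using k speed[of s] u by (metis norm_mult complex_mod_cnj mult_1 norm_of_real)
  have "c' s = u * of_real k"
    using k by (metis uu(2) mult.assoc mult_1)
  obtain t where t: "q = c t" using q(1) by auto
  have "c t \<in> cball (c s) r" using q(3) by (simp add: t dist_norm norm_minus_commute)
  have "c' s \<bullet> (q - c s) = Re (cnj (c' s) * (c t - c s))"
    by (simp add: inner_complex_def t)
  also have "cnj (c' s) * (c t - c s) = of_real k * v t"
    unfolding \<open>c' s = u * of_real k\<close> v_def by simp
  finally have "k * Re (v t) = 0" using perp by simp
  then have "Re (v t) = 0" using \<open>\<bar>k\<bar> = 1\<close> by auto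
  then have "v t = 0" using vc[OF \<open>c t \<in> cball (c s) r\<close>] f(2) by (simp add: complex_eq_iff)
  then have "c t = c s" using u by (auto simp: v_def)
  then show False using q(2) t by simp
qed

text \<open>Up to the period, the pairs that violate the condition at distance at least \<open>r\<close> form a compact
  set, on which the distance attains a minimum larger than \<open>r\<close>.\<close>

lemma (in transverse_curve) transverse_beyond:
  assumes r: "0 < r" and trans: "\<And>s t. c t \<noteq> c s \<Longrightarrow> norm (c t - c s) \<le> r \<Longrightarrow> c' s \<bullet> (c t - c s) \<noteq> 0"
  obtains R' where "r < R'" "\<And>s t. c t \<noteq> c s \<Longrightarrow> norm (c t - c s) < R' \<Longrightarrow> c' s \<bullet> (c t - c s) \<noteq> 0"
proof -
  define n where "n z = norm (c (snd z) - c (fst z))" for z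
  define S where "S = ({0..L} \<times> {0..L}) \<inter> ({z. c' (fst z) \<bullet> (c (snd z) - c (fst z)) = 0} \<inter> {z. r \<le> n z})"
  have cn: "continuous_on UNIV n" unfolding n_def by (intro continuous_intros) auto
  have "closed {z. c' (fst z) \<bullet> (c (snd z) - c (fst z)) = 0}"
    by (intro closed_Collect_eq continuous_intros) auto
  moreover have "closed {z. r \<le> n z}"
    by (intro closed_Collect_le cn) auto
  ultimately have "compact S"
    unfolding S_def by (intro compact_Int_closed compact_Times closed_Int) auto
  have "\<exists>R'>r. \<forall>z\<in>S. R' \<le> n z"
  proof (cases "S = {}")
    case True then show ?thesis by (intro exI[of _ "r + 1"]) auto
  next
    case False
    then obtain m where m: "m \<in> S" "\<And>z. z \<in> S \<Longrightarrow> n m \<le> n z"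
      using continuous_attains_inf[OF \<open>compact S\<close>] continuous_on_subset[OF cn] by blast
    have "n m \<noteq> r"
    proof
      assume "n m = r"
      then have "c (snd m) \<noteq> c (fst m)" "norm (c (snd m) - c (fst m)) \<le> r"
        using r by (auto simp: n_def)
      then show False using trans m(1) by (auto simp: S_def)
    qed
    then have "r < n m" using m(1) by (auto simp: S_def)
    then show ?thesis using m(2) by blast
  qed
  then obtain R' where R': "r < R'" "\<And>z. z \<in> S \<Longrightarrow> R' \<le> n z" by blast
  show thesis
  proof (rule that[OF R'(1)])
    fix s t assume ne: "c t \<noteq> c s" and less: "norm (c t - c s) < R'"
    obtain s' where s': "s' \<in> {0..L}" "c s' = c s" "c' s' = c' s" by (rule base_interval)
    obtain t' where t': "t' \<in> {0..L}" "c t' = c t" by (rule base_interval)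
    show "c' s \<bullet> (c t - c s) \<noteq> 0"
    proof
      assume "c' s \<bullet> (c t - c s) = 0"
      moreover from this have "r < norm (c t - c s)" using trans[OF ne] by force
      ultimately have "(s', t') \<in> S" using s' t' by (simp add: S_def n_def)
      from R'(2)[OF this] show False using less s' t' by (simp add: n_def)
    qed
  qed
qed

lemma TGL_curve_bounding:
  assumes r: "0 < r" and curve: "(L, \<gamma>) \<in> TGL_curves r"
  obtains R where "r < R"
    "bounding_curve \<gamma> (\<lambda>s. vector_derivative \<gamma> (at s))
      (\<lambda>s. vector_derivative (\<lambda>s. vector_derivative \<gamma> (at s)) (at s)) L R"
proof -
  let ?T = "\<lambda>s. vector_derivative \<gamma> (at s)"
  let ?T' = "\<lambda>s. vector_derivative ?T (at s)"
  have C2: "C2_simple_closed_curve L \<gamma>" and TGL: "tangentially_graph_like (region L \<gamma>) r"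
    using curve by (auto simp: TGL_curves_def)
  have L: "0 < L" and per: "\<gamma> (s + L) = \<gamma> s" and inj: "inj_on \<gamma> {0..<L}" for s
    using C2 by (auto simp: C2_simple_closed_curve_def)
  have per_int: "\<gamma> (s + of_int n * L) = \<gamma> s" for n s
    using per by (rule periodic_int)
  (* With R = 0 this makes the Jordan curve theorem available, which identifies the frontier of the
     region with the curve; only then does the graph property speak about points of the curve. *)
  interpret C: transverse_curve \<gamma> ?T ?T' L 0
  proof
    fix s t :: real
    show "(\<gamma> has_vector_derivative ?T s) (at s)" "(?T has_vector_derivative ?T' s) (at s)"
      using C2 by (auto simp: C2_simple_closed_curve_def C1_differentiable_on_eq vector_derivative_works[symmetric])
    show "norm (?T s) = 1" "\<gamma> (s + L) = \<gamma> s" "0 < L"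
      using C2 by (auto simp: C2_simple_closed_curve_def)
    show "\<gamma> (s + t) \<noteq> \<gamma> s" if t: "0 < t" "t < L"
    proof
      assume eq: "\<gamma> (s + t) = \<gamma> s"
      obtain n :: int where n: "0 \<le> s + of_int n * L" "s + of_int n * L < L"
        by (rule shift_into_period[OF L])
      define x where "x = s + of_int n * L"
      note x = n[folded x_def]
      define y where "y = (if x + t < L then x + t else x + t - L)"
      have y: "0 \<le> y" "y < L" "y \<noteq> x" using x t by (auto simp: y_def)
      have "\<gamma> x = \<gamma> s" using per_int[of s n] by (simp add: x_def)
      moreover have "\<gamma> (x + t) = \<gamma> (s + t)"
        using per_int[of "s + t" n] by (simp add: x_def algebra_simps)
      moreover have "\<gamma> y = \<gamma> (x + t)" using per[of "x + t - L"] by (simp add: y_def)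
      ultimately have "\<gamma> y = \<gamma> x" using eq by simp
      then show False using inj x y by (auto simp: inj_on_def)
    qed
  qed auto
  have "?T s \<bullet> (\<gamma> t - \<gamma> s) \<noteq> 0" if "\<gamma> t \<noteq> \<gamma> s" "norm (\<gamma> t - \<gamma> s) \<le> r" for s t
  proof (rule C.graph_like_imp_transverse[OF r _ rangeI that])
    show "tangentially_graph_like_at (region L \<gamma>) (\<gamma> s) r"
      using TGL by (simp add: tangentially_graph_like_def C.frontier_region)
  qed
  then obtain R where R: "r < R" "\<And>s t. \<gamma> t \<noteq> \<gamma> s \<Longrightarrow> norm (\<gamma> t - \<gamma> s) < R \<Longrightarrow> ?T s \<bullet> (\<gamma> t - \<gamma> s) \<noteq> 0"
    using C.transverse_beyond[OF r] by blast
  have "bounding_curve \<gamma> ?T ?T' L R"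
  proof
    fix s t :: real
    show "?T s \<bullet> (\<gamma> t - \<gamma> s) \<noteq> 0" if "\<gamma> t \<noteq> \<gamma> s" "norm (\<gamma> t - \<gamma> s) < R"
      using R(2)[OF that] .
    show "\<forall>\<^sub>F \<epsilon> in at_right 0. \<gamma> s + of_real \<epsilon> * \<i> * ?T s \<in> inside (\<gamma> ` {0..L})"
      using C2 by (auto simp: C2_simple_closed_curve_def)
    show "0 < R" using r R(1) by simp
  qed (use C.L_pos C.c_deriv C.c'_deriv C.speed C.period C.simple in auto)
  with R(1) show thesis by (rule that)
qed

lemma (in bounding_curve) area_invariant_eq: "area_invariant L c = disk_area"
  by (intro ext) (simp add: area_invariant_def disk_area_def region_def trace_eq)

lemma has_partial_r: "has_partial [Dir_r] g s r v \<longleftrightarrow> (g s has_real_derivative v) (at r)"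
proof
  assume "has_partial [Dir_r] g s r v"
  then obtain h where h: "\<forall>\<^sub>F y in nhds r. g s y = h y" "(h has_real_derivative v) (at r)" by auto
  then show "(g s has_real_derivative v) (at r)"
    using DERIV_cong_ev[OF refl h(1) refl] by simp
qed (auto intro: exI[of _ "g s"])

lemma has_partial_s: "has_partial [Dir_s] g s r v \<longleftrightarrow> ((\<lambda>x. g x r) has_real_derivative v) (at s)"
proof
  assume "has_partial [Dir_s] g s r v"
  then obtain h where h: "\<forall>\<^sub>F x in nhds s. g x r = h x" "(h has_real_derivative v) (at s)" by auto
  then show "((\<lambda>x. g x r) has_real_derivative v) (at s)"
    using DERIV_cong_ev[OF refl h(1) refl] by simp
qed (auto intro: exI[of _ "\<lambda>x. g x r"])

text \<open>For \<open>g\<^sub>r\<^sub>r\<close> the function \<open>g\<^sub>r\<close> has to be known on a neighbourhood of the radius.\<close>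

lemma has_partial_rr:
  assumes g: "\<forall>\<^sub>F y in nhds r. (g s has_real_derivative h y) (at y)"
  shows "has_partial [Dir_r, Dir_r] g s r v \<longleftrightarrow> (h has_real_derivative v) (at r)"
proof
  assume "has_partial [Dir_r, Dir_r] g s r v"
  then obtain k where k: "\<forall>\<^sub>F y in nhds r. has_partial [Dir_r] g s y (k y)" "(k has_real_derivative v) (at r)"
    unfolding has_partial.simps(2)[of Dir_r "[Dir_r]"] by auto
  have "\<forall>\<^sub>F y in nhds r. h y = k y"
    using g k(1) unfolding has_partial_r by eventually_elim (rule DERIV_unique)
  then show "(h has_real_derivative v) (at r)"
    using DERIV_cong_ev[OF refl _ refl] k(2) by blast
next
  assume "(h has_real_derivative v) (at r)"
  then show "has_partial [Dir_r, Dir_r] g s r v"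
    unfolding has_partial.simps(2)[of Dir_r "[Dir_r]"] has_partial_r using g by auto
qed

text \<open>With a fixed difference both angles grow together, and so do their sines.\<close>

lemma tilts_determined:
  fixes a a' b b' :: real
  assumes bounds: "\<bar>a\<bar> < pi / 2" "\<bar>b\<bar> < pi / 2" "\<bar>a'\<bar> < pi / 2" "\<bar>b'\<bar> < pi / 2"
    and diff: "b - a = b' - a'" and sum: "sin a + sin b = sin a' + sin b'"
  shows "a = a' \<and> b = b'"
proof -
  have mono: "sin x < sin y" if "\<bar>x\<bar> < pi / 2" "\<bar>y\<bar> < pi / 2" "x < y" for x y :: real
    using that by (intro sin_monotone_2pi) auto
  have "\<not> a < a'"
    using mono[of a a'] mono[of b b'] bounds diff sum by linarith
  moreover have "\<not> a' < a"
    using mono[of a' a] mono[of b' b] bounds diff sum by linarith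
  ultimately show ?thesis using diff by linarith
qed

text \<open>The derivatives \<open>g\<^sub>r\<close> and \<open>g\<^sub>s\<close> determine the two angles; adding the two formulas for the
  curvature shows that \<open>g\<^sub>r\<^sub>r\<close> then determines their radial derivatives, and with them the
  curvature.\<close>

lemma same_data_imp_same_curvature:
  assumes A: "bounding_curve \<gamma> \<gamma>' \<gamma>'' L R1" and B: "bounding_curve \<eta> \<eta>' \<eta>'' L R2"
    and r: "0 < r" "r < R1" "r < R2" and same: "same_data r (L, \<gamma>) (L, \<eta>)" and s: "0 < s" "s < L"
  shows "transverse_curve.curvature \<gamma>' \<gamma>'' s = transverse_curve.curvature \<eta>' \<eta>'' s"
proof -
  interpret A: bounding_curve \<gamma> \<gamma>' \<gamma>'' L R1 by (rule A)
  interpret B: bounding_curve \<eta> \<eta>' \<eta>'' L R2 by (rule B)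
  have data: "has_partial w A.disk_area x r v \<longleftrightarrow> has_partial w B.disk_area x r v"
    if "length w \<in> {1..3}" "x \<in> {0..L}" for w x v
    using same that by (simp add: A.area_invariant_eq B.area_invariant_eq)
  note rA = r(1,2) and rB = r(1,3)
  have angles: "A.exit_angle x r = B.exit_angle x r \<and> A.entry_tilt x r = B.entry_tilt x r"
    if x: "x \<in> {0..L}" for x
  proof (rule tilts_determined)
    have "has_partial [Dir_r] A.disk_area x r (r * (pi + A.entry_tilt x r - A.exit_angle x r))"
      unfolding has_partial_r by (rule A.disk_area_deriv_radius[OF rA])
    then have "has_partial [Dir_r] B.disk_area x r (r * (pi + A.entry_tilt x r - A.exit_angle x r))"
      using data[of "[Dir_r]" x] x by (simp del: has_partial.simps)
    then have "r * (pi + A.entry_tilt x r - A.exit_angle x r) = r * (pi + B.entry_tilt x r - B.exit_angle x r)"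
      unfolding has_partial_r using B.disk_area_deriv_radius[OF rB, of x] by (rule DERIV_unique)
    then show "A.entry_tilt x r - A.exit_angle x r = B.entry_tilt x r - B.exit_angle x r"
      using r by simp
    have "has_partial [Dir_s] A.disk_area x r (- r * (sin (A.exit_angle x r) + sin (A.entry_tilt x r)))"
      unfolding has_partial_s by (rule A.disk_area_deriv_base[OF rA])
    then have "has_partial [Dir_s] B.disk_area x r (- r * (sin (A.exit_angle x r) + sin (A.entry_tilt x r)))"
      using data[of "[Dir_s]" x] x by (simp del: has_partial.simps)
    then have "- r * (sin (A.exit_angle x r) + sin (A.entry_tilt x r)) = - r * (sin (B.exit_angle x r) + sin (B.entry_tilt x r))"
      unfolding has_partial_s using B.disk_area_deriv_base[OF rB, of x] by (rule DERIV_unique)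
    then show "sin (A.exit_angle x r) + sin (A.entry_tilt x r) = sin (B.exit_angle x r) + sin (B.entry_tilt x r)"
      using r by simp
  qed (use A.exit_angle_bounds[OF rA] A.entry_tilt_bounds[OF rA] B.exit_angle_bounds[OF rB] B.entry_tilt_bounds[OF rB] in auto)
  have s_in: "s \<in> {0..L}" using s by simp
  define \<alpha> \<beta> where "\<alpha> = A.exit_angle s r" and "\<beta> = A.entry_tilt s r"
  have \<alpha>\<beta>: "B.exit_angle s r = \<alpha>" "B.entry_tilt s r = \<beta>"
    using angles[OF s_in] by (simp_all add: \<alpha>_def \<beta>_def)
  define k k' where "k = A.curvature s" and "k' = B.curvature s"
  obtain a where a: "(A.exit_angle s has_real_derivative a) (at r)"
    "((\<lambda>s. A.exit_angle s r) has_real_derivative (sin \<alpha> / r + cos \<alpha> * a - k)) (at s)"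
    unfolding \<alpha>_def k_def by (rule A.exit_angle_partials[OF rA])
  obtain b where b: "(A.entry_tilt s has_real_derivative b) (at r)"
    "((\<lambda>s. A.entry_tilt s r) has_real_derivative - (sin \<beta> / r + cos \<beta> * b + k)) (at s)"
    unfolding \<beta>_def k_def by (rule A.entry_tilt_partials[OF rA])
  obtain a' where a': "(B.exit_angle s has_real_derivative a') (at r)"
    "((\<lambda>s. B.exit_angle s r) has_real_derivative (sin \<alpha> / r + cos \<alpha> * a' - k')) (at s)"
    unfolding \<alpha>\<beta>[symmetric] k'_def by (rule B.exit_angle_partials[OF rB])
  obtain b' where b': "(B.entry_tilt s has_real_derivative b') (at r)"
    "((\<lambda>s. B.entry_tilt s r) has_real_derivative - (sin \<beta> / r + cos \<beta> * b' + k')) (at s)"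
    unfolding \<alpha>\<beta>[symmetric] k'_def by (rule B.entry_tilt_partials[OF rB])
  (* Equality of the angles on a neighbourhood of s gives equality of their s-derivatives. *)
  have near: "\<forall>\<^sub>F x in nhds s. x \<in> {0<..<L}"
    using s by (intro eventually_nhds_in_open) auto
  have exit_near: "\<forall>\<^sub>F x in nhds s. A.exit_angle x r = B.exit_angle x r"
    and entry_near: "\<forall>\<^sub>F x in nhds s. A.entry_tilt x r = B.entry_tilt x r"
    by (rule eventually_mono[OF near], use angles in auto)+
  have "((\<lambda>s. B.exit_angle s r) has_real_derivative (sin \<alpha> / r + cos \<alpha> * a - k)) (at s)"
    using a(2) DERIV_cong_ev[OF refl exit_near refl] by blast
  then have exit_eq: "cos \<alpha> * a - k = cos \<alpha> * a' - k'"
    using DERIV_unique[OF a'(2), of "sin \<alpha> / r + cos \<alpha> * a - k"] by simp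
  have "((\<lambda>s. B.entry_tilt s r) has_real_derivative - (sin \<beta> / r + cos \<beta> * b + k)) (at s)"
    using b(2) DERIV_cong_ev[OF refl entry_near refl] by blast
  then have entry_eq: "cos \<beta> * b + k = cos \<beta> * b' + k'"
    using DERIV_unique[OF b'(2), of "- (sin \<beta> / r + cos \<beta> * b + k)"] by simp
  have nearR: "\<forall>\<^sub>F y in nhds r. y \<in> {0<..<min R1 R2}"
    using r by (intro eventually_nhds_in_open) auto
  have gA: "\<forall>\<^sub>F y in nhds r. (A.disk_area s has_real_derivative y * (pi + A.entry_tilt s y - A.exit_angle s y)) (at y)"
    using nearR by eventually_elim (auto intro: A.disk_area_deriv_radius)
  have gB: "\<forall>\<^sub>F y in nhds r. (B.disk_area s has_real_derivative y * (pi + B.entry_tilt s y - B.exit_angle s y)) (at y)"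
    using nearR by eventually_elim (auto intro: B.disk_area_deriv_radius)
  have "((\<lambda>y. y * (pi + A.entry_tilt s y - A.exit_angle s y)) has_real_derivative (pi + \<beta> - \<alpha> + r * (b - a))) (at r)"
    using a(1) b(1) by (auto intro!: derivative_eq_intros simp: \<alpha>_def \<beta>_def)
  then have "has_partial [Dir_r, Dir_r] A.disk_area s r (pi + \<beta> - \<alpha> + r * (b - a))"
    using has_partial_rr[where g = A.disk_area, OF gA] by blast
  then have "has_partial [Dir_r, Dir_r] B.disk_area s r (pi + \<beta> - \<alpha> + r * (b - a))"
    using data[of "[Dir_r, Dir_r]" s] s_in by (simp del: has_partial.simps)
  then have "((\<lambda>y. y * (pi + B.entry_tilt s y - B.exit_angle s y)) has_real_derivative (pi + \<beta> - \<alpha> + r * (b - a))) (at r)"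
    using has_partial_rr[where g = B.disk_area, OF gB] by blast
  moreover have "((\<lambda>y. y * (pi + B.entry_tilt s y - B.exit_angle s y)) has_real_derivative (pi + \<beta> - \<alpha> + r * (b' - a'))) (at r)"
    using a'(1) b'(1) by (auto intro!: derivative_eq_intros simp: \<alpha>\<beta>)
  ultimately have "pi + \<beta> - \<alpha> + r * (b - a) = pi + \<beta> - \<alpha> + r * (b' - a')"
    by (rule DERIV_unique)
  then have "b - a = b' - a'" using r by simp
  then have "(cos \<alpha> + cos \<beta>) * (a - a') = cos \<alpha> * (a - a') + cos \<beta> * (b - b')"
    by (simp add: distrib_right diff_eq_eq)
  also have "\<dots> = 0" using exit_eq entry_eq by (simp add: algebra_simps)
  finally have "(cos \<alpha> + cos \<beta>) * (a - a') = 0" .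
  moreover have "cos \<alpha> > 0" "cos \<beta> > 0"
    using A.exit_angle_bounds[OF rA, of s] A.entry_tilt_bounds[OF rA, of s]
    by (auto simp: \<alpha>_def \<beta>_def intro!: cos_gt_zero_pi)
  ultimately have "a = a'" by auto
  then show ?thesis using exit_eq by (simp add: k_def k'_def)
qed

text \<open>Plane curves with the same curvature are congruent: the quotient of the unit tangents is
  constant.\<close>

lemma same_curvature_imp_congruent:
  assumes A: "transverse_curve \<gamma> \<gamma>' \<gamma>'' L R1" and B: "transverse_curve \<eta> \<eta>' \<eta>'' L R2"
    and same: "\<And>s. 0 < s \<Longrightarrow> s < L \<Longrightarrow>
      transverse_curve.curvature \<gamma>' \<gamma>'' s = transverse_curve.curvature \<eta>' \<eta>'' s"
  shows "\<exists>a \<theta>. \<forall>s. \<eta> s = a + cis \<theta> * \<gamma> s"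
proof -
  interpret A: transverse_curve \<gamma> \<gamma>' \<gamma>'' L R1 by (rule A)
  interpret B: transverse_curve \<eta> \<eta>' \<eta>'' L R2 by (rule B)
  define v where "v = \<eta>' 0 * cnj (\<gamma>' 0)"
  have "norm v = 1" by (simp add: v_def norm_mult A.speed B.speed)
  then have "v = cis (Arg v)"
    by (metis Arg_eq cis_conv_exp mult_1 norm_zero of_real_1 zero_neq_one)
  (* The curvatures are only known to agree inside the interval, so its end points are exceptional. *)
  have quot: "\<eta>' s * cnj (\<gamma>' s) = v" if s: "s \<in> {0..L}" for s
  proof (rule has_derivative_zero_unique_strong_interval[where k = "{0, L}" and f = "\<lambda>s. \<eta>' s * cnj (\<gamma>' s)", OF _ _ _ _ s])
    show "continuous_on {0..L} (\<lambda>s. \<eta>' s * cnj (\<gamma>' s))" by (intro continuous_intros) auto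
    fix x assume "x \<in> {0..L} - {0, L}"
    then have x: "0 < x" "x < L" by auto
    have "\<eta>'' x * cnj (\<gamma>' x) + \<eta>' x * cnj (\<gamma>'' x) = 0"
      unfolding A.c''_eq[of x] B.c''_eq[of x] same[OF x] by simp
    then have zero: "h *\<^sub>R \<eta>'' x * cnj (\<gamma>' x) + \<eta>' x * cnj (h *\<^sub>R \<gamma>'' x) = 0" for h
      by (simp add: scaleR_conv_of_real algebra_simps) (metis distrib_left mult_zero_right)
    have "((\<lambda>s. \<eta>' s * cnj (\<gamma>' s)) has_derivative (\<lambda>h. 0)) (at x)"
      by (rule has_derivative_eq_rhs[OF has_derivative_mult[OF B.has_derivative_c'[OF has_derivative_ident]
            has_derivative_cnj[OF A.has_derivative_c'[OF has_derivative_ident]]]])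
        (use zero in \<open>auto simp: fun_eq_iff algebra_simps\<close>)
    then show "((\<lambda>s. \<eta>' s * cnj (\<gamma>' s)) has_derivative (\<lambda>h. 0)) (at x within {0..L})"
      by (rule has_derivative_at_withinI)
  qed (auto simp: v_def)
  have tangents: "\<eta>' s = v * \<gamma>' s" if "s \<in> {0..L}" for s
  proof -
    have "v * \<gamma>' s = \<eta>' s * (cnj (\<gamma>' s) * \<gamma>' s)"
      unfolding quot[OF that, symmetric] by simp
    then show ?thesis by (simp only: A.c'_unit mult_1_right)
  qed
  define a where "a = \<eta> 0 - v * \<gamma> 0"
  have pos: "\<eta> s - v * \<gamma> s = a" if s: "s \<in> {0..L}" for s
  proof (rule has_derivative_zero_unique_strong_interval[where k = "{}" and f = "\<lambda>s. \<eta> s - v * \<gamma> s", OF _ _ _ _ s])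
    show "continuous_on {0..L} (\<lambda>s. \<eta> s - v * \<gamma> s)" by (intro continuous_intros) auto
    fix x assume "x \<in> {0..L} - {}"
    then have "\<eta>' x = v * \<gamma>' x" using tangents by simp
    then have "((\<lambda>s. \<eta> s - v * \<gamma> s) has_derivative (\<lambda>h. 0)) (at x)"
      by (auto intro!: derivative_eq_intros)
    then show "((\<lambda>s. \<eta> s - v * \<gamma> s) has_derivative (\<lambda>h. 0)) (at x within {0..L})"
      by (rule has_derivative_at_withinI)
  qed (auto simp: a_def)
  have "\<eta> s = a + cis (Arg v) * \<gamma> s" for s
  proof -
    obtain n :: int where "0 \<le> s + of_int n * L" "s + of_int n * L < L"
      by (rule shift_into_period[OF A.L_pos])
    then have "s + of_int n * L \<in> {0..L}" by simp
    from pos[OF this] have "\<eta> s - v * \<gamma> s = a" by (simp add: A.periods B.periods)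
    then show ?thesis using \<open>v = cis (Arg v)\<close> by (metis diff_add_cancel)
  qed
  then show ?thesis by blast
qed

lemma TGL_curve_reconstructible:
  assumes r: "0 < r" and curve: "c \<in> TGL_curves r"
  shows "reconstructible r c"
  unfolding reconstructible_def
proof (intro ballI impI)
  fix c' assume c': "c' \<in> TGL_curves r" and same: "same_data r c c'"
  obtain L \<gamma> where c: "c = (L, \<gamma>)" by (cases c)
  obtain M \<eta> where c'_eq: "c' = (M, \<eta>)" by (cases c')
  have len: "M = L" using same by (simp add: c c'_eq)
  obtain R1 where A: "r < R1" "bounding_curve \<gamma> (\<lambda>s. vector_derivative \<gamma> (at s))
      (\<lambda>s. vector_derivative (\<lambda>s. vector_derivative \<gamma> (at s)) (at s)) L R1"
    using TGL_curve_bounding[OF r] curve c by blast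
  obtain R2 where B: "r < R2" "bounding_curve \<eta> (\<lambda>s. vector_derivative \<eta> (at s))
      (\<lambda>s. vector_derivative (\<lambda>s. vector_derivative \<eta> (at s)) (at s)) L R2"
    using TGL_curve_bounding[OF r] c' c'_eq len by blast
  have "same_data r (L, \<gamma>) (L, \<eta>)" using same by (simp only: c c'_eq len)
  note same_data_imp_same_curvature[OF A(2) B(2) r A(1) B(1) this]
  from same_curvature_imp_congruent[OF bounding_curve.axioms(1)[OF A(2)] bounding_curve.axioms(1)[OF B(2)] this]
  obtain a \<theta> where "\<And>s. \<eta> s = a + cis \<theta> * \<gamma> s" by blast
  then show "equal_up_to_motion c c'"
    unfolding c c'_eq len equal_up_to_motion.simps
    by (intro exI[of _ a] exI[of _ \<theta>] exI[of _ "\<lambda>s. s"]) (auto simp: strict_mono_def)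
qed

theorem theorem28:
  fixes r :: real
  assumes "r > 0"
  shows "C1_dense_in {\<gamma> \<in> TGL_curves r. reconstructible r \<gamma>} (TGL_curves r)"
proof -
  have "C1_close \<epsilon> c c" if "\<epsilon> > 0" for \<epsilon> c
    using that by (cases c) simp
  then show ?thesis
    using TGL_curve_reconstructible[OF assms] unfolding C1_dense_in_def by blast
qed

end
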